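(* Consider the $2$-dimensional transposed Leibniz--Poisson algebras $T_1,T_2,T_3,T_4,T_5^{\beta},T_6,T_7^{\alpha},T_8$ ($\alpha,\beta\in\mathbb C$) and the zero algebra $\mathbb C^8$ (both products zero), as defined in the context. Their orbits have the following dimensions: $4$ for $T_3,T_4$; $3$ for $T_5^{\beta},T_6,T_8$; $2$ for $T_1,T_2,T_7^{\alpha}$; $0$ for $\mathbb C^8$. For two algebras $T,T'$ of this list one has $T\to T'$ if and only if $T\cong T'$ or $T'$ can be reached from $T$ by a chain of the following degenerations: $T_3\to T_5^{0}$; $T_3\to T_6$; $T_4\to T_5^{0}$; $T_4\to T_1$; $T_4\to T_7^{\alpha}$ for all $\alpha\in\mathbb C$; $T_5^{\beta}\to T_7^{0}$ for all $\beta\in\mathbb C$; $T_6\to T_7^{0}$; $T_8\to T_7^{0}$; $T_8\to T_2$; $T_1\to\mathbb C^8$; $T_2\to\mathbb C^8$; $T_7^{\alpha}\to\mathbb C^8$ for all $\alpha\in\mathbb C$.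
   Context: A transposed Leibniz--Poisson algebra is a complex vector space with a commutative associative product $\cdot$ and a bilinear bracket $[-,-]$ satisfying $[[x,y],z]=[[x,z],y]+[x,[y,z]]$ and $[x,[y,z]]=[[x,y],z]+[y,[x,z]]$ (symmetric Leibniz), such that $2[x,y]\cdot z=[x\cdot z,y]+[x,y\cdot z]$. Fix a $2$-dimensional complex vector space $V$ with basis $e_1,e_2$. A $2$-dimensional such algebra is viewed as a pair $(\mu,\mu')\in \mathrm{Bil}(V\times V,V)^2\cong\mathbb C^{16}$ ($\mu$ is $\cdot$, $\mu'$ is the bracket). $\mathrm{GL}(V)$ acts by $(g*(\mu,\mu'))(x,y)=(g\mu(g^{-1}x,g^{-1}y),\,g\mu'(g^{-1}x,g^{-1}y))$; $O(T)$ is the orbit of a structure representing $T$. We write $T\to T'$ ($T$ degenerates to $T'$) if a structure representing $T'$ lies in the Zariski closure $\overline{O(T)}$. The algebras are (unlisted products are zero, $\cdot$ is commutative): $T_1: [e_1,e_1]=e_2$; $T_2: [e_1,e_2]=e_2,\ [e_2,e_1]=-e_2$; $T_3: e_1\cdot e_1=e_1,\ e_2\cdot e_2=e_2$; $T_4: e_1\cdot e_1=e_1,\ e_1\cdot e_2=e_2,\ [e_1,e_1]=e_2$; $T_5^{\alpha}: e_1\cdot e_1=e_1,\ e_1\cdot e_2=e_2,\ [e_1,e_2]=\alpha e_2,\ [e_2,e_1]=-\alpha e_2$; $T_6: e_1\cdot e_1=e_1$; $T_7^{\alpha}: e_1\cdot e_1=e_2,\ [e_1,e_1]=\alpha e_2$;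 $T_8: e_1\cdot e_1=e_2,\ [e_1,e_2]=e_2,\ [e_2,e_1]=-e_2$. *)

theory Defs
  imports "HOL-Analysis.Analysis" "HOL-Library.Extended_Nat"
begin

type_synonym V = "complex^2"
type_synonym bracket_pair = "(V \<Rightarrow> V \<Rightarrow> V) \<times> (V \<Rightarrow> V \<Rightarrow> V)"

definition e1 :: V where "e1 = axis 1 1"
definition e2 :: V where "e2 = axis 2 1"

text \<open>The library's \<^const>\<open>bilinear\<close> is real bilinearity, hence the following.\<close>

definition complex_bilinear :: "(V \<Rightarrow> V \<Rightarrow> V) \<Rightarrow> bool" where
  "complex_bilinear b \<longleftrightarrow>
     (\<forall>y. Vector_Spaces.linear (*s) (*s) (\<lambda>x. b x y)) \<and>
     (\<forall>x. Vector_Spaces.linear (*s) (*s) (\<lambda>y. b x y))"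

definition Bil2 :: "bracket_pair set" where
  "Bil2 = {(m, b). complex_bilinear m \<and> complex_bilinear b}"

definition transposed_Leibniz_Poisson :: "bracket_pair \<Rightarrow> bool" where
  "transposed_Leibniz_Poisson = (\<lambda>(m, b).
     complex_bilinear m \<and> complex_bilinear b \<and>
     (\<forall>x y. m x y = m y x) \<and>
     (\<forall>x y z. m (m x y) z = m x (m y z)) \<and>
     (\<forall>x y z. b (b x y) z = b (b x z) y + b x (b y z)) \<and>
     (\<forall>x y z. b x (b y z) = b (b x y) z + b y (b x z)) \<and>
     (\<forall>x y z. 2 *s m (b x y) z = b (m x z) y + b x (m y z)))"

definition GL_V :: "(V \<Rightarrow> V) set" where
  "GL_V = {g. Vector_Spaces.linear (*s) (*s) g \<and> bij g}"

definition act :: "(V \<Rightarrow> V) \<Rightarrow> bracket_pair \<Rightarrow> bracket_pair" where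
  "act g = (\<lambda>(m, b). (\<lambda>x y. g (m (inv g x) (inv g y)), \<lambda>x y. g (b (inv g x) (inv g y))))"

definition orbit :: "bracket_pair \<Rightarrow> bracket_pair set" where
  "orbit A = (\<lambda>g. act g A) ` GL_V"

definition isomorphic :: "bracket_pair \<Rightarrow> bracket_pair \<Rightarrow> bool" where
  "isomorphic = (\<lambda>(m, b) (m', b').
     \<exists>f\<in>GL_V. \<forall>x y. f (m x y) = m' (f x) (f y) \<and> f (b x y) = b' (f x) (f y))"

text \<open>Polynomial functions in the sixteen structure constants with respect to the basis
  \<^const>\<open>e1\<close>, \<^const>\<open>e2\<close>, which is the standard basis \<open>axis i 1\<close>.\<close>

inductive polynomial_fun :: "(bracket_pair \<Rightarrow> complex) \<Rightarrow> bool" where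
  const: "polynomial_fun (\<lambda>_. c)"
| coord_fst: "polynomial_fun (\<lambda>A. fst A (axis i 1) (axis j 1) $ k)"
| coord_snd: "polynomial_fun (\<lambda>A. snd A (axis i 1) (axis j 1) $ k)"
| add: "polynomial_fun p \<Longrightarrow> polynomial_fun q \<Longrightarrow> polynomial_fun (\<lambda>A. p A + q A)"
| mult: "polynomial_fun p \<Longrightarrow> polynomial_fun q \<Longrightarrow> polynomial_fun (\<lambda>A. p A * q A)"

definition zero_locus :: "(bracket_pair \<Rightarrow> complex) set \<Rightarrow> bracket_pair set" where
  "zero_locus P = {A \<in> Bil2. \<forall>p\<in>P. p A = 0}"

definition zariski :: "bracket_pair topology" where
  "zariski = topology (\<lambda>U. \<exists>P. P \<subseteq> Collect polynomial_fun \<and> U = Bil2 - zero_locus P)"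

lemma zero_locus_subset: "zero_locus P \<subseteq> Bil2"
  unfolding zero_locus_def by blast

lemma istopology_zariski:
  "istopology (\<lambda>U. \<exists>P. P \<subseteq> Collect polynomial_fun \<and> U = Bil2 - zero_locus P)"
  unfolding istopology_def
proof (intro conjI allI impI)
  fix S T
  assume "\<exists>P. P \<subseteq> Collect polynomial_fun \<and> S = Bil2 - zero_locus P"
    and "\<exists>P. P \<subseteq> Collect polynomial_fun \<and> T = Bil2 - zero_locus P"
  then obtain P Q where P: "P \<subseteq> Collect polynomial_fun" "S = Bil2 - zero_locus P"
    and Q: "Q \<subseteq> Collect polynomial_fun" "T = Bil2 - zero_locus Q"
    by blast
  define R where "R = (\<lambda>(p, q) A. p A * q A :: complex) ` (P \<times> Q)"
  have "R \<subseteq> Collect polynomial_fun"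
  proof
    fix r assume "r \<in> R"
    then obtain p q where "p \<in> P" "q \<in> Q" "r = (\<lambda>A. p A * q A)"
      unfolding R_def by auto
    then show "r \<in> Collect polynomial_fun"
      using P(1) Q(1) polynomial_fun.mult[of p q] by blast
  qed
  moreover have "A \<in> zero_locus R \<longleftrightarrow> A \<in> zero_locus P \<or> A \<in> zero_locus Q" for A
  proof -
    have "(\<forall>r\<in>R. r A = 0) \<longleftrightarrow> (\<forall>p\<in>P. \<forall>q\<in>Q. p A = 0 \<or> q A = 0)"
      unfolding R_def by simp
    then show ?thesis
      unfolding zero_locus_def by blast
  qed
  then have "S \<inter> T = Bil2 - zero_locus R"
    unfolding P(2) Q(2) by blast
  ultimately show "\<exists>R. R \<subseteq> Collect polynomial_fun \<and> S \<inter> T = Bil2 - zero_locus R"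
    by blast
next
  fix \<K>
  assume K: "\<forall>K\<in>\<K>. \<exists>P. P \<subseteq> Collect polynomial_fun \<and> K = Bil2 - zero_locus P"
  obtain P where P: "\<forall>K\<in>\<K>. P K \<subseteq> Collect polynomial_fun \<and> K = Bil2 - zero_locus (P K)"
    using bchoice[OF K] by blast
  have "\<Union>\<K> = (\<Union>K\<in>\<K>. Bil2 - zero_locus (P K))"
    using P by blast
  also have "\<dots> = Bil2 - zero_locus (\<Union>K\<in>\<K>. P K)"
    unfolding zero_locus_def by blast
  finally have "\<Union>\<K> = Bil2 - zero_locus (\<Union>K\<in>\<K>. P K)" .
  moreover have "(\<Union>K\<in>\<K>. P K) \<subseteq> Collect polynomial_fun"
    using P by blast
  ultimately show "\<exists>R. R \<subseteq> Collect polynomial_fun \<and> \<Union>\<K> = Bil2 - zero_locus R"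
    by blast
qed

lemma openin_zariski:
  "openin zariski U \<longleftrightarrow> (\<exists>P. P \<subseteq> Collect polynomial_fun \<and> U = Bil2 - zero_locus P)"
  unfolding zariski_def topology_inverse'[OF istopology_zariski] by (rule refl)

lemma topspace_zariski: "topspace zariski = Bil2"
proof
  show "topspace zariski \<subseteq> Bil2"
    using openin_topspace[of zariski] unfolding openin_zariski by blast
  have "zero_locus {\<lambda>_. 1} = {}" "{\<lambda>_. 1} \<subseteq> Collect polynomial_fun"
    using polynomial_fun.const[of 1] by (simp_all add: zero_locus_def)
  then have "openin zariski Bil2"
    unfolding openin_zariski by (intro exI[of _ "{\<lambda>_. 1}"]) simp
  then show "Bil2 \<subseteq> topspace zariski"
    by (rule openin_subset)
qed

lemma closedin_zariski:
  "closedin zariski Z \<longleftrightarrow> (\<exists>P. P \<subseteq> Collect polynomial_fun \<and> Z = zero_locus P)"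
proof -
  have "Z \<subseteq> Bil2 \<and> Bil2 - Z = Bil2 - zero_locus P \<longleftrightarrow> Z = zero_locus P" for P
    using zero_locus_subset[of P] by blast
  then show ?thesis
    unfolding closedin_def topspace_zariski openin_zariski by blast
qed

definition degenerates_to :: "bracket_pair \<Rightarrow> bracket_pair \<Rightarrow> bool" where
  "degenerates_to A B \<longleftrightarrow> (\<exists>B'. isomorphic B B' \<and> B' \<in> zariski closure_of (orbit A))"

definition irreducible_space :: "'a topology \<Rightarrow> bool" where
  "irreducible_space X \<longleftrightarrow> topspace X \<noteq> {} \<and>
     (\<forall>F G. closedin X F \<and> closedin X G \<and> F \<union> G = topspace X
        \<longrightarrow> F = topspace X \<or> G = topspace X)"

text \<open>Supremum of the lengths of chains \<open>Z 0 \<subset> \<dots> \<subset> Z n\<close> of irreducible closed subsets. The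
  value for the empty space is \<open>0\<close>, not \<open>-\<infinity>\<close>; orbits are never empty.\<close>

definition krull_dim :: "'a topology \<Rightarrow> enat" where
  "krull_dim X = Sup {enat n | n. \<exists>Z :: nat \<Rightarrow> 'a set.
     (\<forall>i\<le>n. closedin X (Z i) \<and> irreducible_space (subtopology X (Z i))) \<and>
     (\<forall>i<n. Z i \<subset> Z (Suc i))}"

definition orbit_dim :: "bracket_pair \<Rightarrow> enat" where
  "orbit_dim A = krull_dim (subtopology zariski (orbit A))"

definition bil :: "V \<Rightarrow> V \<Rightarrow> V \<Rightarrow> V \<Rightarrow> V \<Rightarrow> V \<Rightarrow> V" where
  "bil p11 p12 p21 p22 x y =
     (x$1 * y$1) *s p11 + (x$1 * y$2) *s p12 + (x$2 * y$1) *s p21 + (x$2 * y$2) *s p22"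

lemma bil_basis:
  "bil p11 p12 p21 p22 e1 e1 = p11" "bil p11 p12 p21 p22 e1 e2 = p12"
  "bil p11 p12 p21 p22 e2 e1 = p21" "bil p11 p12 p21 p22 e2 e2 = p22"
  by (simp_all add: bil_def e1_def e2_def axis_def)

datatype alg_name = T1 | T2 | T3 | T4 | T5 complex | T6 | T7 complex | T8 | Zero

fun alg :: "alg_name \<Rightarrow> bracket_pair" where
  "alg T1 = (bil 0 0 0 0, bil e2 0 0 0)"
| "alg T2 = (bil 0 0 0 0, bil 0 e2 (- e2) 0)"
| "alg T3 = (bil e1 0 0 e2, bil 0 0 0 0)"
| "alg T4 = (bil e1 e2 e2 0, bil e2 0 0 0)"
| "alg (T5 \<alpha>) = (bil e1 e2 e2 0, bil 0 (\<alpha> *s e2) (- (\<alpha> *s e2)) 0)"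
| "alg T6 = (bil e1 0 0 0, bil 0 0 0 0)"
| "alg (T7 \<alpha>) = (bil e2 0 0 0, bil (\<alpha> *s e2) 0 0 0)"
| "alg T8 = (bil e2 0 0 0, bil 0 e2 (- e2) 0)"
| "alg Zero = (bil 0 0 0 0, bil 0 0 0 0)"

inductive basic_degeneration :: "alg_name \<Rightarrow> alg_name \<Rightarrow> bool" where
  "basic_degeneration T3 (T5 0)"
| "basic_degeneration T3 T6"
| "basic_degeneration T4 (T5 0)"
| "basic_degeneration T4 T1"
| "basic_degeneration T4 (T7 \<alpha>)"
| "basic_degeneration (T5 \<beta>) (T7 0)"
| "basic_degeneration T6 (T7 0)"
| "basic_degeneration T8 (T7 0)"
| "basic_degeneration T8 T2"
| "basic_degeneration T1 Zero"
| "basic_degeneration T2 Zero"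
| "basic_degeneration (T7 \<alpha>) Zero"

end

(*
Dimensions. A chain Z_0 < ... < Z_n of irreducible closed subsets of an orbit gives polynomials
q_1, ..., q_n, with q_i vanishing on Z_(i-1) but not on Z_i, whose monomials are linearly independent
on Z_n. An orbit that is parametrised polynomially by d-space, or by a d-dimensional quadric
x y + z w = 1 (times a line), carries only O(D^d) independent polynomials of degree D, while q_1, ..., q_n
have (D + 1)^n monomials with exponents at most D; hence n <= d. Conversely, the closures in the orbit
of the sets g * A, with g in a flag of affine subspaces of matrices, form a chain of the required length.

Degenerations. Each one is the limit at s = 0 of a family of structures that are isomorphic to the
given one for s /= 0. All other degenerations are excluded by conditions that are polynomial in the
structure constants and invariant under isomorphism.
*)
theory Submission
  imports Defs "HOL-Library.Function_Algebras"
begin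

section \<open>Linear independence of functions\<close>

text \<open>The counting argument plays the part of transcendence degree: a longer chain would force
  more algebraically independent polynomials than the parameters can carry. The bound is only as
  good as the parametrisation. The matrix entries and the inverse determinant give at best the
  dimension 4 of GL_2, so each smaller orbit needs parameters adapted to its stabiliser. For
  \<open>T1\<close> and \<open>T7\<close> a cube root absorbs the scaling and leaves two parameters.
  For \<open>T3\<close> to \<open>T6\<close> the natural datum is the image v of the idempotent
  \<open>e1\<close> together with the linear form xi dual to it in the transported basis. The
  relation xi(v) = 1 is the quadric, of dimension 3 in four coordinates; \<open>T3\<close> and
  \<open>T4\<close> need one more scalar, the determinant or its inverse. For the lower bounds,
  irreducibility is tested on lines of matrices, where it comes down to a nonzero polynomial in one
  variable having finitely many roots.\<close>

interpretation fun_space: vector_space "\<lambda>(c::complex) (f :: 'a \<Rightarrow> complex) x. c * f x"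
  by unfold_locales (auto simp: fun_eq_iff algebra_simps)

lemma sum_fun_apply: "(\<Sum>i\<in>I. f i) x = (\<Sum>i\<in>I. f i x)"
  for f :: "'i \<Rightarrow> 'a \<Rightarrow> complex"
  by (induction I rule: infinite_finite_induct) auto

text \<open>A family and not a set of functions: two indices whose functions agree on
  \<open>Z\<close> already violate it, so that it is the number of indices that gets
  bounded.\<close>

definition indep_family :: "'a set \<Rightarrow> 'i set \<Rightarrow> ('i \<Rightarrow> 'a \<Rightarrow> complex) \<Rightarrow> bool" where
  "indep_family Z I f \<longleftrightarrow> (\<forall>c. (\<forall>x\<in>Z. (\<Sum>i\<in>I. c i * f i x) = 0) \<longrightarrow> (\<forall>i\<in>I. c i = 0))"

lemma indep_familyD:
  "indep_family Z I f \<Longrightarrow> (\<And>x. x \<in> Z \<Longrightarrow> (\<Sum>i\<in>I. c i * f i x) = 0) \<Longrightarrow> i \<in> I \<Longrightarrow> c i = 0"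
  unfolding indep_family_def by blast

definition in_span_on :: "'a set \<Rightarrow> ('a \<Rightarrow> complex) set \<Rightarrow> ('a \<Rightarrow> complex) \<Rightarrow> bool" where
  "in_span_on Z B f \<longleftrightarrow> (\<exists>h\<in>fun_space.span B. \<forall>x\<in>Z. f x = h x)"

text \<open>Each \<open>f i\<close> agrees on \<open>Z\<close> with some \<open>h i\<close> in the
  span. A relation between the \<open>h i\<close> that holds everywhere restricts to a relation
  between the \<open>f i\<close> on \<open>Z\<close>, hence is trivial, and the exchange lemma
  applies to the \<open>h i\<close>.\<close>

lemma card_indep_family_le:
  assumes "finite I" "finite B" "indep_family Z I f"
    and sp: "\<And>i. i \<in> I \<Longrightarrow> in_span_on Z B (f i)"
  shows "card I \<le> card B"
proof -
  obtain h where h: "\<And>i. i \<in> I \<Longrightarrow> h i \<in> fun_space.span B"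
    "\<And>i x. i \<in> I \<Longrightarrow> x \<in> Z \<Longrightarrow> f i x = h i x"
    using sp unfolding in_span_on_def by metis
  have zero: "c i = 0" if "\<And>x. (\<Sum>i\<in>I. c i * h i x) = 0" "i \<in> I" for c i
    by (rule indep_familyD[OF assms(3)]) (use that h(2) in \<open>simp_all cong: sum.cong\<close>)
  have inj: "inj_on h I"
  proof (rule inj_onI, rule ccontr)
    fix i j assume ij: "i \<in> I" "j \<in> I" "h i = h j" "i \<noteq> j"
    \<comment> \<open>If \<open>h i = h j\<close>, the coefficients 1 at \<open>i\<close> and -1 at
      \<open>j\<close> give a nontrivial relation.\<close>
    define c :: "_ \<Rightarrow> complex" where "c = (\<lambda>k. of_bool (k = i) - of_bool (k = j))"
    have "(\<Sum>k\<in>I. c k * h k x) = 0" for x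
      using ij \<open>finite I\<close>
      by (simp add: c_def left_diff_distrib sum_subtractf of_bool_def if_distrib[of "\<lambda>u. u * _"]
          cong: if_cong)
    from zero[OF this ij(1)] show False
      using ij(4) by (simp add: c_def)
  qed
  have "fun_space.independent (h ` I)"
  proof (rule fun_space.independent_if_scalars_zero)
    fix u g assume s: "(\<Sum>g\<in>h ` I. (\<lambda>x. u g * g x)) = 0" and "g \<in> h ` I"
    then obtain i where i: "i \<in> I" "g = h i" by auto
    have "(\<Sum>i\<in>I. u (h i) * h i x) = 0" for x
      using fun_cong[OF s, of x] inj by (simp add: sum_fun_apply sum.reindex)
    from zero[OF this i(1)] show "u g = 0" using i(2) by simp
  qed (use \<open>finite I\<close> in simp)
  then have "card (h ` I) \<le> card B"
    using fun_space.independent_span_bound[OF \<open>finite B\<close>] h(1) by blast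
  then show ?thesis
    using inj by (simp add: card_image)
qed

section \<open>Monomials with bounded exponents\<close>

primrec monomial :: "('a \<Rightarrow> complex) list \<Rightarrow> nat list \<Rightarrow> 'a \<Rightarrow> complex" where
  "monomial [] = (\<lambda>a x. 1)"
| "monomial (q # qs) = (\<lambda>a x. q x ^ hd a * monomial qs (tl a) x)"

text \<open>Each exponent is bounded by \<open>D\<close>, not the total degree, so that the count is
  exactly \<open>(D + 1) ^ n\<close>.\<close>

definition exponents :: "nat \<Rightarrow> nat \<Rightarrow> nat list set" where
  "exponents n D = {a. set a \<subseteq> {..D} \<and> length a = n}"

lemma finite_exponents [simp]: "finite (exponents n D)"
  unfolding exponents_def by (simp add: finite_lists_length_eq)

lemma card_exponents: "card (exponents n D) = (D + 1) ^ n"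
  unfolding exponents_def by (simp add: card_lists_length_eq)

lemma exponents_0: "exponents 0 D = {[]}"
  by (auto simp: exponents_def)

lemma sum_exponents_Suc:
  "(\<Sum>a\<in>exponents (Suc n) D. g a) = (\<Sum>j\<le>D. \<Sum>a\<in>exponents n D. g (j # a))"
proof -
  have "exponents (Suc n) D = (\<lambda>(j, a). j # a) ` ({..D} \<times> exponents n D)"
    by (auto simp: exponents_def length_Suc_conv image_iff)
  moreover have "inj_on (\<lambda>(j, a). j # a) ({..D} \<times> exponents n D)"
    by (auto simp: inj_on_def)
  ultimately show ?thesis
    by (simp add: sum.reindex sum.cartesian_product case_prod_unfold)
qed

section \<open>Irreducible sets\<close>

text \<open>Primality of the vanishing ideal of \<open>Z\<close>: the form of irreducibility that
  can be applied to single polynomials.\<close>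

definition irreducible_set :: "bracket_pair set \<Rightarrow> bool" where
  "irreducible_set Z \<longleftrightarrow> Z \<noteq> {} \<and>
     (\<forall>p q. polynomial_fun p \<and> polynomial_fun q \<and> (\<forall>A\<in>Z. p A * q A = 0) \<longrightarrow>
        (\<forall>A\<in>Z. p A = 0) \<or> (\<forall>A\<in>Z. q A = 0))"

lemma irreducible_space_iff:
  assumes "Z \<subseteq> Bil2"
  shows "irreducible_space (subtopology zariski Z) \<longleftrightarrow> irreducible_set Z"
proof -
  have top: "topspace (subtopology zariski Z) = Z"
    using assms by (auto simp: topspace_zariski)
  have cl: "closedin (subtopology zariski Z) F \<longleftrightarrow>
      (\<exists>P. P \<subseteq> Collect polynomial_fun \<and> F = Z \<inter> zero_locus P)" for F
    by (auto simp: closedin_subtopology closedin_zariski)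
  show ?thesis
  proof
    assume L: "irreducible_space (subtopology zariski Z)"
    show "irreducible_set Z"
      unfolding irreducible_set_def
    proof (intro conjI allI impI)
      show "Z \<noteq> {}" using L unfolding irreducible_space_def top by blast
      fix p q assume pq: "polynomial_fun p \<and> polynomial_fun q \<and> (\<forall>A\<in>Z. p A * q A = 0)"
      have "closedin (subtopology zariski Z) (Z \<inter> zero_locus {p})"
        "closedin (subtopology zariski Z) (Z \<inter> zero_locus {q})"
        using pq unfolding cl by blast+
      moreover have "Z \<inter> zero_locus {p} \<union> Z \<inter> zero_locus {q} = Z"
        using pq assms by (auto simp: zero_locus_def)
      ultimately have "Z \<inter> zero_locus {p} = Z \<or> Z \<inter> zero_locus {q} = Z"
        using L unfolding irreducible_space_def top by blast
      then show "(\<forall>A\<in>Z. p A = 0) \<or> (\<forall>A\<in>Z. q A = 0)"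
        by (auto simp: zero_locus_def)
    qed
  next
    assume R: "irreducible_set Z"
    show "irreducible_space (subtopology zariski Z)"
      unfolding irreducible_space_def top
    proof (intro conjI allI impI)
      show "Z \<noteq> {}" using R by (simp add: irreducible_set_def)
      fix F G assume "closedin (subtopology zariski Z) F \<and> closedin (subtopology zariski Z) G
        \<and> F \<union> G = Z"
      then obtain P Q where P: "P \<subseteq> Collect polynomial_fun" "F = Z \<inter> zero_locus P"
        and Q: "Q \<subseteq> Collect polynomial_fun" "G = Z \<inter> zero_locus Q" and FG: "F \<union> G = Z"
        unfolding cl by blast
      show "F = Z \<or> G = Z"
      proof (rule ccontr)
        assume neq: "\<not> (F = Z \<or> G = Z)"
        obtain A p where "A \<in> Z" "p \<in> P" "p A \<noteq> 0"
          using neq P(2) assms unfolding zero_locus_def by blast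
        moreover obtain B q where "B \<in> Z" "q \<in> Q" "q B \<noteq> 0"
          using neq Q(2) assms unfolding zero_locus_def by blast
        moreover have "\<forall>A\<in>Z. p A * q A = 0"
        proof
          fix A assume "A \<in> Z"
          then have "A \<in> zero_locus P \<or> A \<in> zero_locus Q" using FG P(2) Q(2) by auto
          then show "p A * q A = 0"
            using \<open>p \<in> P\<close> \<open>q \<in> Q\<close> by (auto simp: zero_locus_def)
        qed
        ultimately show False
          using R P(1) Q(1) unfolding irreducible_set_def by blast
      qed
    qed
  qed
qed

lemma polynomial_fun_sum:
  "(\<And>i. i \<in> I \<Longrightarrow> polynomial_fun (f i)) \<Longrightarrow> polynomial_fun (\<lambda>A. \<Sum>i\<in>I. f i A)"
  by (induction I rule: infinite_finite_induct) (auto intro: polynomial_fun.intros)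

lemma polynomial_fun_power: "polynomial_fun f \<Longrightarrow> polynomial_fun (\<lambda>A. f A ^ n)"
  by (induction n) (auto intro: polynomial_fun.intros)

lemma polynomial_fun_monomial:
  "set qs \<subseteq> Collect polynomial_fun \<Longrightarrow> polynomial_fun (monomial qs a)"
proof (induction qs arbitrary: a)
  case (Cons q qs)
  then show ?case
    by (auto intro: polynomial_fun.mult polynomial_fun_power)
qed (auto intro: polynomial_fun.const)

text \<open>A relation between the monomials that holds on the larger set can be divided by the
  lowest power of \<open>q\<close> that occurs, and what remains restricts to a relation on the smaller set.\<close>

lemma indep_monomials_Cons:
  assumes ind: "indep_family Z' (exponents n D) (monomial qs)"
    and Z: "irreducible_set Z" "Z' \<subseteq> Z"
    and qs: "set qs \<subseteq> Collect polynomial_fun" "polynomial_fun q"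
    and q: "\<And>A. A \<in> Z' \<Longrightarrow> q A = 0" "\<exists>A\<in>Z. q A \<noteq> 0"
  shows "indep_family Z (exponents (Suc n) D) (monomial (q # qs))"
  unfolding indep_family_def
proof (intro allI impI)
  fix c assume c: "\<forall>A\<in>Z. (\<Sum>a\<in>exponents (Suc n) D. c a * monomial (q # qs) a A) = 0"
  define G where "G j A = (\<Sum>a\<in>exponents n D. c (j # a) * monomial qs a A)" for j A
  have G: "polynomial_fun (G j)" for j
    unfolding G_def
    by (intro polynomial_fun_sum polynomial_fun.mult polynomial_fun.const
        polynomial_fun_monomial qs)
  have rel: "(\<Sum>j\<le>D. q A ^ j * G j A) = 0" if "A \<in> Z" for A
    using c that by (simp add: sum_exponents_Suc G_def sum_distrib_left mult.left_commute)
  have "j \<le> D \<Longrightarrow> \<forall>a\<in>exponents n D. c (j # a) = 0" for j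
  proof (induction j rule: less_induct)
    case (less j)
    have G0: "G i A = 0" if "i < j" for i A
      using less that by (simp add: G_def)
    define R where "R A = (\<Sum>i\<le>D - j. q A ^ i * G (i + j) A)" for A
    have R: "polynomial_fun R"
      unfolding R_def
      by (intro polynomial_fun_sum polynomial_fun.mult polynomial_fun_power qs G)
    have "q A ^ j * R A = 0" if "A \<in> Z" for A
    proof -
      have "(\<Sum>i\<le>D. q A ^ i * G i A) = (\<Sum>i=j..D. q A ^ i * G i A)"
        by (rule sum.mono_neutral_right) (auto simp: G0)
      also have "\<dots> = (\<Sum>i\<le>D - j. q A ^ (i + j) * G (i + j) A)"
        using less.prems
        by (intro sum.reindex_bij_witness[of _ "\<lambda>i. i + j" "\<lambda>i. i - j"]) auto
      also have "\<dots> = q A ^ j * R A"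
        by (simp add: R_def sum_distrib_left power_add mult_ac)
      finally show ?thesis using rel[OF that] by simp
    qed
    moreover have "\<not> (\<forall>A\<in>Z. q A ^ j = 0)"
      using q(2) by auto
    \<comment> \<open>Irreducibility of \<open>Z\<close> cancels the factor \<open>q A ^ j\<close>,
      since no power of \<open>q\<close> vanishes identically on \<open>Z\<close>.\<close>
    ultimately have RZ: "\<forall>A\<in>Z. R A = 0"
      using Z(1) R polynomial_fun_power[OF qs(2), of j] unfolding irreducible_set_def by blast
    have "G j A = 0" if "A \<in> Z'" for A
    proof -
      have "R A = (\<Sum>i\<le>D - j. if i = 0 then G j A else 0)"
        unfolding R_def using q(1)[OF that] by (intro sum.cong) auto
      then show ?thesis using RZ Z(2) that by auto
    qed
    then show ?case
      using indep_familyD[OF ind, of "\<lambda>a. c (j # a)"] unfolding G_def by blast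
  qed
  then show "\<forall>a\<in>exponents (Suc n) D. c a = 0"
    by (auto simp: exponents_def length_Suc_conv)
qed

text \<open>One list \<open>qs\<close> serves every \<open>D\<close>; this uniformity allows
  \<open>D\<close> to grow in the dimension count. Its head separates the two largest sets of the
  chain.\<close>

lemma chain_indep_monomials:
  assumes "\<And>i. i \<le> n \<Longrightarrow> irreducible_set (Z i)"
    and "\<And>i. i < n \<Longrightarrow> Z i \<subseteq> Z (Suc i)"
    and "\<And>i. i < n \<Longrightarrow> \<exists>q. polynomial_fun q \<and> (\<forall>A\<in>Z i. q A = 0) \<and> (\<exists>A\<in>Z (Suc i). q A \<noteq> 0)"
  shows "\<exists>qs. length qs = n \<and> set qs \<subseteq> Collect polynomial_fun \<and>
    (\<forall>D. indep_family (Z n) (exponents n D) (monomial qs))"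
  using assms
proof (induction n)
  case 0
  then have "Z 0 \<noteq> {}" by (auto simp: irreducible_set_def)
  then show ?case by (auto simp: indep_family_def exponents_0)
next
  case (Suc n)
  then obtain qs where qs: "length qs = n" "set qs \<subseteq> Collect polynomial_fun"
    "\<And>D. indep_family (Z n) (exponents n D) (monomial qs)"
    by (metis le_SucI less_SucI)
  obtain q where q: "polynomial_fun q" "\<forall>A\<in>Z n. q A = 0" "\<exists>A\<in>Z (Suc n). q A \<noteq> 0"
    using Suc.prems(3)[of n] by auto
  have "indep_family (Z (Suc n)) (exponents (Suc n) D) (monomial (q # qs))" for D
    by (rule indep_monomials_Cons[OF qs(3)]) (use Suc.prems qs q in auto)
  then show ?case
    using qs(1,2) q(1) by (intro exI[of _ "q # qs"]) (auto simp del: monomial.simps)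
qed

section \<open>Upper bounds for the dimension\<close>

text \<open>These are functions with an upper bound for the degree of some expression in the
  generators, not formal polynomials. Relations between the generators, such as the equation of the
  quadric, therefore hold as equalities of values.\<close>

inductive poly_deg :: "('a \<Rightarrow> complex) set \<Rightarrow> nat \<Rightarrow> ('a \<Rightarrow> complex) \<Rightarrow> bool"
  for G :: "('a \<Rightarrow> complex) set" where
  const: "poly_deg G 0 (\<lambda>_. c)"
| gen: "g \<in> G \<Longrightarrow> poly_deg G 1 g"
| add: "poly_deg G n f \<Longrightarrow> poly_deg G n g \<Longrightarrow> poly_deg G n (\<lambda>x. f x + g x)"
| mult: "poly_deg G m f \<Longrightarrow> poly_deg G n g \<Longrightarrow> poly_deg G (m + n) (\<lambda>x. f x * g x)"
| weaken: "poly_deg G m f \<Longrightarrow> m \<le> n \<Longrightarrow> poly_deg G n f"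

definition poly_over :: "('a \<Rightarrow> complex) set \<Rightarrow> ('a \<Rightarrow> complex) \<Rightarrow> bool" where
  "poly_over G f \<longleftrightarrow> (\<exists>n. poly_deg G n f)"

lemma poly_over_const [intro]: "poly_over G (\<lambda>_. c)"
  unfolding poly_over_def using poly_deg.const by blast

lemma poly_over_gen [intro]: "g \<in> G \<Longrightarrow> poly_over G g"
  unfolding poly_over_def using poly_deg.gen by blast

lemma poly_over_add [intro]:
  assumes "poly_over G f" "poly_over G g"
  shows "poly_over G (\<lambda>x. f x + g x)"
proof -
  obtain m n where "poly_deg G m f" "poly_deg G n g"
    using assms unfolding poly_over_def by blast
  then have "poly_deg G (max m n) (\<lambda>x. f x + g x)"
    by (intro poly_deg.add) (auto intro: poly_deg.weaken)
  then show ?thesis unfolding poly_over_def by blast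
qed

lemma poly_over_mult [intro]:
  "poly_over G f \<Longrightarrow> poly_over G g \<Longrightarrow> poly_over G (\<lambda>x. f x * g x)"
  unfolding poly_over_def using poly_deg.mult by blast

lemma poly_over_minus [intro]:
  assumes "poly_over G f" shows "poly_over G (\<lambda>x. - f x)"
  using poly_over_mult[OF poly_over_const[of G "-1"] assms] by simp

lemma poly_over_diff [intro]:
  assumes "poly_over G f" "poly_over G g" shows "poly_over G (\<lambda>x. f x - g x)"
  using poly_over_add[OF assms(1) poly_over_minus[OF assms(2)]] by simp

lemma poly_over_power [intro]: "poly_over G f \<Longrightarrow> poly_over G (\<lambda>x. f x ^ n)"
  by (induction n) (auto intro: poly_over_const)

lemma poly_deg_power: "poly_deg G k f \<Longrightarrow> poly_deg G (k * n) (\<lambda>x. f x ^ n)"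
proof (induction n)
  case (Suc n)
  then show ?case using poly_deg.mult[of G k f "k * n"] by simp
qed (auto intro: poly_deg.const)

definition poly_param :: "('p \<Rightarrow> complex) set \<Rightarrow> ('p \<Rightarrow> bracket_pair) \<Rightarrow> bool" where
  "poly_param G \<Phi> \<longleftrightarrow>
     (\<forall>i j k. poly_over G (\<lambda>x. fst (\<Phi> x) (axis i 1) (axis j 1) $ k)) \<and>
     (\<forall>i j k. poly_over G (\<lambda>x. snd (\<Phi> x) (axis i 1) (axis j 1) $ k))"

lemma poly_over_polynomial_fun:
  "polynomial_fun p \<Longrightarrow> poly_param G \<Phi> \<Longrightarrow> poly_over G (\<lambda>x. p (\<Phi> x))"
  by (induction rule: polynomial_fun.induct) (auto simp: poly_param_def)

lemma poly_deg_list: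
  assumes "poly_param G \<Phi>" "set qs \<subseteq> Collect polynomial_fun"
  shows "\<exists>k. \<forall>q\<in>set qs. poly_deg G k (\<lambda>x. q (\<Phi> x))"
  using assms(2)
proof (induction qs)
  case (Cons q qs)
  then obtain k l where "\<forall>q\<in>set qs. poly_deg G k (\<lambda>x. q (\<Phi> x))" "poly_deg G l (\<lambda>x. q (\<Phi> x))"
    using poly_over_polynomial_fun[OF _ assms(1), of q] unfolding poly_over_def by auto
  then have "\<forall>q\<in>set (q # qs). poly_deg G (max k l) (\<lambda>x. q (\<Phi> x))"
    by (auto intro: poly_deg.weaken)
  then show ?case by blast
qed simp

lemma poly_deg_monomial:
  assumes "\<forall>q\<in>set qs. poly_deg G k (\<lambda>x. q (\<Phi> x))" "a \<in> exponents (length qs) D"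
  shows "poly_deg G (k * D * length qs) (\<lambda>x. monomial qs a (\<Phi> x))"
  using assms
proof (induction qs arbitrary: a)
  case (Cons q qs)
  then obtain j a' where a: "a = j # a'" "j \<le> D" "a' \<in> exponents (length qs) D"
    by (auto simp: exponents_def length_Suc_conv)
  have "poly_deg G (k * j + k * D * length qs)
      (\<lambda>x. q (\<Phi> x) ^ j * monomial qs a' (\<Phi> x))"
    using Cons a by (intro poly_deg.mult poly_deg_power) auto
  then show ?case
    unfolding a(1)
    by (rule poly_deg.weaken[THEN back_subst[of "poly_deg G _"]])
      (use a(2) in \<open>auto simp: fun_eq_iff algebra_simps\<close>)
qed (auto intro: poly_deg.const)

text \<open>Every point of \<open>Z n\<close> is a value of \<open>\<Phi>\<close> on
  \<open>Y\<close>, so the independent monomials on \<open>Z n\<close> pull back to independent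
  functions on \<open>Y\<close>. These have degree at most \<open>k * D * n\<close>, linear in
  \<open>D\<close>, and compete with a spanning set of size of order \<open>D ^ d\<close>.\<close>

lemma krull_dim_le:
  fixes \<Phi> :: "'p \<Rightarrow> bracket_pair"
  assumes "X \<subseteq> Bil2" and cover: "X \<subseteq> \<Phi> ` Y" and param: "poly_param G \<Phi>"
    and fin: "\<And>n. finite (B n)" and card: "\<And>n. card (B n) \<le> C * (n + 1) ^ d"
    and span: "\<And>n f. poly_deg G n f \<Longrightarrow> in_span_on Y (B n) f"
  shows "krull_dim (subtopology zariski X) \<le> enat d"
  unfolding krull_dim_def
proof (rule Sup_least, clarify)
  fix n and Z :: "nat \<Rightarrow> bracket_pair set"
  assume closed_irr: "\<forall>i\<le>n. closedin (subtopology zariski X) (Z i) \<and>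
      irreducible_space (subtopology (subtopology zariski X) (Z i))"
    and strict: "\<forall>i<n. Z i \<subset> Z (Suc i)"
  have ZX: "Z i \<subseteq> X" if "i \<le> n" for i
    using closed_irr that closedin_subset by fastforce
  have irr: "irreducible_set (Z i)" if "i \<le> n" for i
    using closed_irr that ZX[OF that] \<open>X \<subseteq> Bil2\<close> irreducible_space_iff[of "Z i"]
    by (auto simp: subtopology_subtopology Int_absorb1)
  have sep: "\<exists>q. polynomial_fun q \<and> (\<forall>A\<in>Z i. q A = 0) \<and> (\<exists>A\<in>Z (Suc i). q A \<noteq> 0)"
    if i: "i < n" for i
  proof -
    have "closedin (subtopology zariski X) (Z i)"
      using closed_irr that by auto
    then obtain P where P: "P \<subseteq> Collect polynomial_fun" "Z i = zero_locus P \<inter> X"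
      by (auto simp: closedin_subtopology closedin_zariski)
    obtain A where A: "A \<in> Z (Suc i)" "A \<notin> Z i"
      using strict i by blast
    then have "A \<in> X" using ZX[of "Suc i"] that by auto
    then have "\<exists>p\<in>P. p A \<noteq> 0"
      using A(2) P(2) \<open>X \<subseteq> Bil2\<close> by (auto simp: zero_locus_def)
    then show ?thesis
      using A(1) P by (auto simp: zero_locus_def)
  qed
  have mono: "Z i \<subseteq> Z (Suc i)" if "i < n" for i
    using strict that by blast
  obtain qs where qs: "length qs = n" "set qs \<subseteq> Collect polynomial_fun"
    "\<And>D. indep_family (Z n) (exponents n D) (monomial qs)"
    using chain_indep_monomials[of n Z, OF irr mono sep] by auto
  obtain k where k: "\<forall>q\<in>set qs. poly_deg G k (\<lambda>x. q (\<Phi> x))"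
    using poly_deg_list[OF param qs(2)] by blast
  have count: "(D + 1) ^ n \<le> C * (k * n + 1) ^ d * (D + 1) ^ d" for D
  proof -
    have "indep_family Y (exponents n D) (\<lambda>a x. monomial qs a (\<Phi> x))"
      unfolding indep_family_def
    proof (intro allI impI)
      fix c assume c: "\<forall>x\<in>Y. (\<Sum>a\<in>exponents n D. c a * monomial qs a (\<Phi> x)) = 0"
      have "(\<Sum>a\<in>exponents n D. c a * monomial qs a A) = 0" if "A \<in> Z n" for A
        using c cover ZX[of n] that by blast
      then show "\<forall>a\<in>exponents n D. c a = 0"
        using indep_familyD[OF qs(3)[of D], of c] by blast
    qed
    then have "card (exponents n D) \<le> card (B (k * D * n))"
      using poly_deg_monomial[OF k, of _ D] fin span qs(1)
      by (intro card_indep_family_le[where Z = Y]) auto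
    then have "(D + 1) ^ n \<le> C * (k * D * n + 1) ^ d"
      using card[of "k * D * n"] by (simp add: card_exponents)
    \<comment> \<open>This splits the bound into a constant that does not involve \<open>D\<close>
      and the power \<open>(D + 1) ^ d\<close>.\<close>
    also have "\<dots> \<le> C * ((k * n + 1) * (D + 1)) ^ d"
      by (intro mult_le_mono power_mono) (auto simp: algebra_simps)
    finally show ?thesis
      unfolding power_mult_distrib by (simp only: mult.assoc)
  qed
  have "n \<le> d"
  proof (rule ccontr)
    assume "\<not> n \<le> d"
    then obtain e where e: "n = d + Suc e"
      by (metis add_Suc_right less_imp_Suc_add not_le)
    \<comment> \<open>Taking \<open>D\<close> equal to the constant in front turns the estimate,
      after cancelling \<open>(D + 1) ^ d\<close>, into
      \<open>(D + 1) ^ Suc e \<le> D\<close>.\<close>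
    define D where "D = C * (k * n + 1) ^ d"
    have "(D + 1) ^ (d + Suc e) \<le> D * (D + 1) ^ d"
      using count[of D] e by (simp only: D_def)
    then have "(D + 1) ^ d * (D + 1) ^ Suc e \<le> (D + 1) ^ d * D"
      by (simp only: power_add mult.commute[of D])
    then have "(D + 1) ^ Suc e \<le> D"
      by (rule mult_left_le_imp_le) simp
    moreover have "D + 1 \<le> (D + 1) ^ Suc e"
      using self_le_power[of "D + 1" "Suc e"] by simp
    ultimately show False by simp
  qed
  then show "enat n \<le> enat d" by simp
qed

section \<open>Spanning sets for affine space and for the quadric\<close>

lemma monomial_mult:
  "a \<in> exponents (length qs) m \<Longrightarrow> b \<in> exponents (length qs) n \<Longrightarrow>
    \<exists>c\<in>exponents (length qs) (m + n). monomial qs c = (\<lambda>x. monomial qs a x * monomial qs b x)"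
proof (induction qs arbitrary: a b)
  case Nil
  then show ?case by (auto simp: exponents_def)
next
  case (Cons q qs)
  then obtain i a' j b' where ab: "a = i # a'" "b = j # b'" "i \<le> m" "j \<le> n"
    "a' \<in> exponents (length qs) m" "b' \<in> exponents (length qs) n"
    by (auto simp: exponents_def length_Suc_conv)
  from Cons.IH[OF ab(5,6)] obtain c where c: "c \<in> exponents (length qs) (m + n)"
    "monomial qs c = (\<lambda>x. monomial qs a' x * monomial qs b' x)" by blast
  then show ?case
    using ab by (intro bexI[of _ "(i + j) # c"])
      (auto simp: exponents_def fun_eq_iff power_add)
qed

lemma monomial_zeros: "monomial qs (replicate (length qs) 0) = (\<lambda>x. 1)"
  by (induction qs) auto

lemma monomial_gen:
  "g \<in> set gs \<Longrightarrow> \<exists>a\<in>exponents (length gs) 1. monomial gs a = g"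
proof (induction gs)
  case (Cons h gs)
  show ?case
  proof (cases "g = h")
    case True
    then show ?thesis
      by (intro bexI[of _ "1 # replicate (length gs) 0"])
        (auto simp: exponents_def monomial_zeros)
  next
    case False
    then obtain a where "a \<in> exponents (length gs) 1" "monomial gs a = g"
      using Cons by auto
    then show ?thesis
      by (intro bexI[of _ "0 # a"]) (auto simp: exponents_def)
  qed
qed simp

text \<open>For fixed \<open>h\<close>, the functions whose product with \<open>h\<close> lies in
  the span of \<open>C\<close> form a subspace. This is applied with \<open>h\<close> in
  \<open>B\<close>, and then with the roles of the factors exchanged and
  \<open>h = f\<close>.\<close>

lemma span_mult:
  fixes A B C :: "('a \<Rightarrow> complex) set"
  assumes "\<And>a b. a \<in> A \<Longrightarrow> b \<in> B \<Longrightarrow> (\<lambda>x. a x * b x) \<in> fun_space.span C"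
    and f: "f \<in> fun_space.span A" and g: "g \<in> fun_space.span B"
  shows "(\<lambda>x. f x * g x) \<in> fun_space.span C"
proof -
  have sub: "fun_space.subspace {f. (\<lambda>x. f x * h x) \<in> fun_space.span C}" for h
  proof (rule fun_space.subspaceI; clarify)
    show "(\<lambda>x. 0 x * h x) \<in> fun_space.span C"
      using fun_space.span_zero[of C] by (simp add: zero_fun_def)
  next
    fix f g assume "(\<lambda>x. f x * h x) \<in> fun_space.span C" "(\<lambda>x. g x * h x) \<in> fun_space.span C"
    from fun_space.span_add[OF this]
    show "(\<lambda>x. (f + g) x * h x) \<in> fun_space.span C"
      by (simp add: plus_fun_def distrib_right)
  next
    fix c f assume "(\<lambda>x. f x * h x) \<in> fun_space.span C"
    from fun_space.span_scale[OF this, of c]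
    show "(\<lambda>x. c * f x * h x) \<in> fun_space.span C"
      by (simp add: mult.assoc)
  qed
  have "(\<lambda>x. f x * b x) \<in> fun_space.span C" if "b \<in> B" for b
    using fun_space.span_minimal[OF _ sub[of b], of A] assms(1)[OF _ that] f by blast
  then have "B \<subseteq> {g. (\<lambda>x. g x * f x) \<in> fun_space.span C}"
    by (auto simp: mult.commute)
  from fun_space.span_minimal[OF this sub] g show ?thesis
    by (auto simp: mult.commute)
qed

lemma poly_deg_in_span:
  "poly_deg (set gs) n f \<Longrightarrow> f \<in> fun_space.span (monomial gs ` exponents (length gs) n)"
proof (induction rule: poly_deg.induct)
  case (const c)
  have "monomial gs (replicate (length gs) 0) \<in> monomial gs ` exponents (length gs) 0"
    by (intro imageI) (auto simp: exponents_def)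
  from fun_space.span_scale[OF fun_space.span_base[OF this], of c]
  show ?case by (simp add: monomial_zeros)
next
  case (gen g)
  then show ?case using monomial_gen[of g gs] by (auto intro!: fun_space.span_base)
next
  case (add n f g)
  then show ?case using fun_space.span_add[of f _ g] by (simp add: plus_fun_def)
next
  case (mult m f n g)
  show ?case
  proof (rule span_mult[OF _ mult.IH])
    fix a b assume "a \<in> monomial gs ` exponents (length gs) m" "b \<in> monomial gs ` exponents (length gs) n"
    then obtain u v where "u \<in> exponents (length gs) m" "a = monomial gs u"
      "v \<in> exponents (length gs) n" "b = monomial gs v" by blast
    then have "(\<lambda>x. a x * b x) \<in> monomial gs ` exponents (length gs) (m + n)"
      using monomial_mult[of u gs m v n] by (metis image_eqI)
    then show "(\<lambda>x. a x * b x) \<in> fun_space.span (monomial gs ` exponents (length gs) (m + n))"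
      by (rule fun_space.span_base)
  qed
next
  case (weaken m f n)
  have "exponents (length gs) m \<subseteq> exponents (length gs) n"
    using \<open>m \<le> n\<close> by (auto simp: exponents_def)
  then show ?case
    using weaken fun_space.span_mono[OF image_mono] by blast
qed

lemma krull_dim_le_affine:
  assumes "X \<subseteq> Bil2" "X \<subseteq> range \<Phi>" "poly_param (set gs) \<Phi>"
  shows "krull_dim (subtopology zariski X) \<le> enat (length gs)"
proof (rule krull_dim_le[OF assms, of "\<lambda>n. monomial gs ` exponents (length gs) n" 1])
  fix n
  show "card (monomial gs ` exponents (length gs) n) \<le> 1 * (n + 1) ^ length gs"
    using card_image_le[of "exponents (length gs) n" "monomial gs"]
    by (simp add: card_exponents)
qed (use poly_deg_in_span in \<open>auto simp: in_span_on_def\<close>)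

lemma in_span_on_base: "b \<in> B \<Longrightarrow> (\<And>x. x \<in> Y \<Longrightarrow> f x = b x) \<Longrightarrow> in_span_on Y B f"
  unfolding in_span_on_def using fun_space.span_base by blast

lemma in_span_on_diff:
  assumes "in_span_on Y B f" "in_span_on Y B g" "\<And>x. x \<in> Y \<Longrightarrow> h x = f x - g x"
  shows "in_span_on Y B h"
proof -
  obtain f' g' where "f' \<in> fun_space.span B" "\<forall>x\<in>Y. f x = f' x"
    "g' \<in> fun_space.span B" "\<forall>x\<in>Y. g x = g' x"
    using assms(1,2) unfolding in_span_on_def by blast
  then show ?thesis
    unfolding in_span_on_def
    using assms(3) by (intro bexI[of _ "f' - g'"]) (auto intro: fun_space.span_diff)
qed

lemma in_span_on_trans:
  assumes "f \<in> fun_space.span A" "\<And>a. a \<in> A \<Longrightarrow> in_span_on Y B a"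
  shows "in_span_on Y B f"
proof -
  have "fun_space.subspace (Collect (in_span_on Y B))"
  proof (rule fun_space.subspaceI; clarify)
    show "in_span_on Y B 0"
      unfolding in_span_on_def using fun_space.span_zero by blast
  next
    fix f g assume "in_span_on Y B f" "in_span_on Y B g"
    then obtain f' g' where "f' \<in> fun_space.span B" "\<forall>x\<in>Y. f x = f' x"
      "g' \<in> fun_space.span B" "\<forall>x\<in>Y. g x = g' x"
      unfolding in_span_on_def by blast
    then show "in_span_on Y B (f + g)"
      unfolding in_span_on_def by (intro bexI[of _ "f' + g'"]) (auto intro: fun_space.span_add)
  next
    fix c f assume "in_span_on Y B f"
    then obtain f' where "f' \<in> fun_space.span B" "\<forall>x\<in>Y. f x = f' x"
      unfolding in_span_on_def by blast
    then show "in_span_on Y B (\<lambda>x. c * f x)"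
      unfolding in_span_on_def
      by (intro bexI[of _ "\<lambda>x. c * f' x"]) (auto intro: fun_space.span_scale)
  qed
  then show ?thesis
    using fun_space.span_minimal[of A "Collect (in_span_on Y B)"] assms by blast
qed

text \<open>On the quadric \<open>g1 g2 + g3 g4 = 1\<close> every polynomial is a combination of monomials that
  do not involve both \<open>g1\<close> and \<open>g2\<close>.\<close>

lemma krull_dim_le_quadric:
  assumes "X \<subseteq> Bil2" "X \<subseteq> \<Phi> ` Y" "poly_param (set (g1 # g2 # g3 # g4 # gs)) \<Phi>"
    and quadric: "\<And>x. x \<in> Y \<Longrightarrow> g1 x * g2 x + g3 x * g4 x = 1"
  shows "krull_dim (subtopology zariski X) \<le> enat (3 + length gs)"
proof -
  \<comment> \<open>Each replacement of \<open>g1 g2\<close> by \<open>1 - g3 g4\<close> may raise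
    the exponents of \<open>g3\<close> and \<open>g4\<close> by one, and at most \<open>n\<close>
    replacements occur. Hence the bound \<open>2 * n\<close>.\<close>
  define E where "E n = exponents (3 + length gs) (2 * n)" for n
  define B where "B n = monomial (g1 # g3 # g4 # gs) ` E n \<union> monomial (g2 # g3 # g4 # gs) ` E n"
    for n
  have finE: "finite (E n)" for n by (simp add: E_def)
  \<comment> \<open>The exponent \<open>i\<close> of \<open>g1\<close> bounds the number of
    replacements still to come; the invariants \<open>k + i \<le> 2 * n\<close> and
    \<open>l + i \<le> 2 * n\<close> reserve room for them.\<close>
  have red: "in_span_on Y (B n) (monomial (g1 # g2 # g3 # g4 # gs) (i # j # k # l # a))"
    if "i \<le> n" "j \<le> n" "k + i \<le> 2 * n" "l + i \<le> 2 * n" "a \<in> exponents (length gs) n"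
    for n i j k l a
    using that
  proof (induction i arbitrary: j k l)
    case 0
    then have "j # k # l # a \<in> E n" by (auto simp: E_def exponents_def)
    then show ?case
      by (intro in_span_on_base[of "monomial (g2 # g3 # g4 # gs) (j # k # l # a)"])
        (auto simp: B_def simp del: monomial.simps(2), auto)
  next
    case (Suc i)
    show ?case
    proof (cases j)
      case 0
      then have "Suc i # k # l # a \<in> E n" using Suc.prems by (auto simp: E_def exponents_def)
      then show ?thesis
        unfolding 0
        by (intro in_span_on_base[of "monomial (g1 # g3 # g4 # gs) (Suc i # k # l # a)"])
          (auto simp: B_def simp del: monomial.simps(2), auto)
    next
      case j: (Suc j')
      show ?thesis
      proof (rule in_span_on_diff)
        show "in_span_on Y (B n) (monomial (g1 # g2 # g3 # g4 # gs) (i # j' # k # l # a))"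
          "in_span_on Y (B n) (monomial (g1 # g2 # g3 # g4 # gs) (i # j' # Suc k # Suc l # a))"
          using Suc.prems j by (intro Suc.IH; simp)+
        fix x assume "x \<in> Y"
        from quadric[OF this] have q: "g1 x * g2 x = 1 - g3 x * g4 x" by (simp add: algebra_simps)
        have "monomial (g1 # g2 # g3 # g4 # gs) (Suc i # j # k # l # a) x =
            (g1 x * g2 x) * monomial (g1 # g2 # g3 # g4 # gs) (i # j' # k # l # a) x"
          by (simp add: j mult_ac)
        then show "monomial (g1 # g2 # g3 # g4 # gs) (Suc i # j # k # l # a) x =
            monomial (g1 # g2 # g3 # g4 # gs) (i # j' # k # l # a) x -
            monomial (g1 # g2 # g3 # g4 # gs) (i # j' # Suc k # Suc l # a) x"
          unfolding q by (simp add: algebra_simps)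
      qed
    qed
  qed
  show ?thesis
  \<comment> \<open>The factor 2 counts the families without \<open>g2\<close> and without
    \<open>g1\<close>; the power of 2 comes from \<open>2 * n + 1 \<le> 2 * (n + 1)\<close>.\<close>
  proof (rule krull_dim_le[OF assms(1-3), of B "2 * 2 ^ (3 + length gs)"])
    fix n
    show "finite (B n)" by (simp add: B_def finE)
    have "card (B n) \<le> card (E n) + card (E n)"
      unfolding B_def by (rule order_trans[OF card_Un_le add_mono]; rule card_image_le[OF finE])
    also have "\<dots> = 2 * (2 * n + 1) ^ (3 + length gs)"
      by (simp add: E_def card_exponents del: power_Suc)
    also have "\<dots> \<le> 2 * (2 * (n + 1)) ^ (3 + length gs)"
      by (intro mult_le_mono power_mono) auto
    finally show "card (B n) \<le> 2 * 2 ^ (3 + length gs) * (n + 1) ^ (3 + length gs)"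
      unfolding power_mult_distrib by (simp only: mult.assoc)
    fix f assume "poly_deg (set (g1 # g2 # g3 # g4 # gs)) n f"
    from poly_deg_in_span[OF this] show "in_span_on Y (B n) f"
    proof (rule in_span_on_trans)
      fix m assume "m \<in> monomial (g1 # g2 # g3 # g4 # gs) `
        exponents (length (g1 # g2 # g3 # g4 # gs)) n"
      then obtain b where b: "b \<in> exponents (Suc (Suc (Suc (Suc (length gs))))) n"
        and m: "m = monomial (g1 # g2 # g3 # g4 # gs) b"
        by (auto simp del: monomial.simps(2))
      obtain i j k l a where "b = i # j # k # l # a" "length a = length gs"
        using b by (auto simp: exponents_def length_Suc_conv)
      then show "in_span_on Y (B n) m"
        unfolding m using b by (auto simp: exponents_def simp del: monomial.simps(2) intro!: red)
    qed
  qed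
qed

section \<open>Coordinates\<close>

lemma vec2_eq_iff: "(x :: 'a^2) = y \<longleftrightarrow> x $ 1 = y $ 1 \<and> x $ 2 = y $ 2"
  by (simp add: vec_eq_iff forall_2)

lemma e1_nth [simp]: "e1 $ 1 = 1" "e1 $ 2 = 0"
  and e2_nth [simp]: "e2 $ 1 = 0" "e2 $ 2 = 1"
  by (simp_all add: e1_def e2_def axis_def)

lemma axis_eq_e1: "axis 1 1 = e1" and axis_eq_e2: "axis 2 1 = e2"
  by (simp_all add: e1_def e2_def)

lemma bil_nth [simp]:
  "bil p11 p12 p21 p22 x y $ i =
     x$1 * y$1 * p11$i + x$1 * y$2 * p12$i + x$2 * y$1 * p21$i + x$2 * y$2 * p22$i"
  by (simp add: bil_def)

lemma complex_linear_iff: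
  "Vector_Spaces.linear (*s) (*s) (f :: V \<Rightarrow> V) \<longleftrightarrow>
     (\<forall>x y. f (x + y) = f x + f y) \<and> (\<forall>c x. f (c *s x) = c *s f x)"
  by (simp add: Vector_Spaces.linear_iff vec.vector_space_axioms)

lemma complex_bilinear_iff:
  "complex_bilinear m \<longleftrightarrow>
     (\<forall>x x' y. m (x + x') y = m x y + m x' y) \<and> (\<forall>c x y. m (c *s x) y = c *s m x y) \<and>
     (\<forall>x y y'. m x (y + y') = m x y + m x y') \<and> (\<forall>c x y. m x (c *s y) = c *s m x y)"
  unfolding complex_bilinear_def complex_linear_iff by blast

lemma complex_bilinear_bil [simp]: "complex_bilinear (bil p11 p12 p21 p22)"
  by (auto simp: complex_bilinear_iff vec2_eq_iff algebra_simps)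

lemma complex_bilinear_eq_bil:
  assumes "complex_bilinear m"
  shows "m = bil (m e1 e1) (m e1 e2) (m e2 e1) (m e2 e2)"
proof (intro ext)
  fix x y
  have "m x y = m (x$1 *s e1 + x$2 *s e2) (y$1 *s e1 + y$2 *s e2)"
    by (rule arg_cong2[of _ _ _ _ m]) (simp_all add: vec2_eq_iff)
  also have "\<dots> = bil (m e1 e1) (m e1 e2) (m e2 e1) (m e2 e2) x y"
    using assms by (simp add: complex_bilinear_iff vec2_eq_iff algebra_simps)
  finally show "m x y = bil (m e1 e1) (m e1 e2) (m e2 e1) (m e2 e2) x y" .
qed

lemma alg_Bil2 [simp]: "alg t \<in> Bil2"
  by (cases t) (simp_all add: Bil2_def)

definition lin :: "complex \<Rightarrow> complex \<Rightarrow> complex \<Rightarrow> complex \<Rightarrow> V \<Rightarrow> V" where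
  "lin a b c d x = vector [a * x$1 + b * x$2, c * x$1 + d * x$2]"

lemma lin_nth [simp]: "lin a b c d x $ 1 = a * x$1 + b * x$2" "lin a b c d x $ 2 = c * x$1 + d * x$2"
  by (simp_all add: lin_def vector_2)

lemma lin_inverse:
  assumes "a * d - b * c = D" "D \<noteq> 0"
  shows "lin (d / D) (- b / D) (- c / D) (a / D) (lin a b c d x) = x"
    and "lin a b c d (lin (d / D) (- b / D) (- c / D) (a / D) x) = x"
proof -
  have *: "p / D * u + q / D * v = (p * u + q * v) / D" for p q u v
    by (simp add: add_divide_distrib)
  show "lin (d / D) (- b / D) (- c / D) (a / D) (lin a b c d x) = x"
    unfolding vec2_eq_iff lin_nth * nonzero_divide_eq_eq[OF assms(2)]
    unfolding assms(1)[symmetric] by (simp add: algebra_simps)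
  have **: "p * (q / D * u + r / D * v) + p' * (q' / D * u + r' / D * v) =
      (p * (q * u + r * v) + p' * (q' * u + r' * v)) / D" for p q r p' q' r' u v
    by (simp add: add_divide_distrib distrib_left)
  show "lin a b c d (lin (d / D) (- b / D) (- c / D) (a / D) x) = x"
    unfolding vec2_eq_iff lin_nth ** nonzero_divide_eq_eq[OF assms(2)]
    unfolding assms(1)[symmetric] by (simp add: algebra_simps)
qed

lemma lin_GL:
  assumes "a * d - b * c \<noteq> 0" shows "lin a b c d \<in> GL_V"
proof -
  note inverse = lin_inverse[OF refl assms]
  have "bij (lin a b c d)"
    by (rule bijI[OF inj_on_inverseI surjI]; rule inverse)
  moreover have "Vector_Spaces.linear (*s) (*s) (lin a b c d)"
    by (auto simp: complex_linear_iff vec2_eq_iff algebra_simps)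
  ultimately show ?thesis by (simp add: GL_V_def)
qed

lemma inv_lin:
  assumes "a * d - b * c = D" "D \<noteq> 0"
  shows "inv (lin a b c d) = lin (d / D) (- b / D) (- c / D) (a / D)"
  by (rule inv_unique_comp; rule ext) (simp_all only: o_apply id_apply lin_inverse[OF assms])

lemma GL_V_cases:
  assumes "g \<in> GL_V"
  obtains a b c d where "a * d - b * c \<noteq> 0" "g = lin a b c d"
proof -
  have lin: "g (x + y) = g x + g y" "g (k *s x) = k *s g x" for x y k
    using assms by (auto simp: GL_V_def complex_linear_iff)
  define a where "a = g e1 $ 1"
  define b where "b = g e2 $ 1"
  define c where "c = g e1 $ 2"
  define d where "d = g e2 $ 2"
  have g: "g = lin a b c d"
  proof
    fix x :: V
    have "g x = g (x$1 *s e1 + x$2 *s e2)"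
      by (rule arg_cong[of _ _ g]) (simp add: vec2_eq_iff)
    then show "g x = lin a b c d x"
      by (simp add: lin vec2_eq_iff a_def b_def c_def d_def mult.commute)
  qed
  have "inj g" using assms by (auto simp: GL_V_def bij_def)
  have "a * d - b * c \<noteq> 0"
  proof
    assume 0: "a * d - b * c = 0"
    \<comment> \<open>Up to sign, these arguments are the columns of the adjugate matrix, which lie
      in the kernel when the determinant is 0.\<close>
    then have "lin a b c d (d *s e1 - c *s e2) = lin a b c d 0"
      "lin a b c d (b *s e1 - a *s e2) = lin a b c d 0"
      using 0 by (simp_all add: vec2_eq_iff mult.commute)
    then have "d *s e1 - c *s e2 = 0" "b *s e1 - a *s e2 = 0"
      using injD[OF \<open>inj g\<close>] unfolding g by blast+
    then have "a = 0" "b = 0" "c = 0" "d = 0"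
      by (auto simp: vec2_eq_iff)
    then have "lin a b c d e1 = lin a b c d 0"
      by (simp add: vec2_eq_iff)
    then have "e1 = 0"
      using injD[OF \<open>inj g\<close>] unfolding g by blast
    then show False
      by (simp add: vec2_eq_iff)
  qed
  then show ?thesis using that g by blast
qed

lemma orbit_cases:
  assumes "B \<in> orbit A"
  obtains a b c d where "a * d - b * c \<noteq> 0" "B = act (lin a b c d) A"
  using assms unfolding orbit_def by (auto elim: GL_V_cases)

lemma GL_V_inv: "g \<in> GL_V \<Longrightarrow> inv g \<in> GL_V"
proof (elim GL_V_cases)
  fix a b c d assume D: "a * d - b * c \<noteq> (0::complex)" and g: "g = lin a b c d"
  obtain D' where D': "a * d - b * c = D'" "D' \<noteq> 0" using D by blast
  then have "d / D' * (a / D') - (- b / D') * (- c / D') = 1 / D'"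
    by (simp add: field_simps)
  then show "inv g \<in> GL_V"
    using D' unfolding g inv_lin[OF D'] by (intro lin_GL) simp
qed

lemma act_Bil2: "g \<in> GL_V \<Longrightarrow> A \<in> Bil2 \<Longrightarrow> act g A \<in> Bil2"
proof -
  assume "g \<in> GL_V" "A \<in> Bil2"
  then have "Vector_Spaces.linear (*s) (*s) g" "Vector_Spaces.linear (*s) (*s) (inv g)"
    using GL_V_inv[of g] by (auto simp: GL_V_def)
  then show ?thesis
    using \<open>A \<in> Bil2\<close>
    by (auto simp: Bil2_def act_def complex_bilinear_iff complex_linear_iff split: prod.splits)
qed

lemma orbit_Bil2: "A \<in> Bil2 \<Longrightarrow> orbit A \<subseteq> Bil2"
  unfolding orbit_def using act_Bil2 by blast

lemma isomorphic_iff_orbit: "isomorphic A B \<longleftrightarrow> B \<in> orbit A"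
proof
  assume "isomorphic A B"
  then obtain f where f: "f \<in> GL_V" "\<And>x y. f (fst A x y) = fst B (f x) (f y)"
    "\<And>x y. f (snd A x y) = snd B (f x) (f y)"
    by (auto simp: isomorphic_def case_prod_unfold)
  have "f (inv f x) = x" for x
    using f(1) by (auto simp: GL_V_def bij_def surj_f_inv_f)
  then have "B = act f A"
    by (simp add: act_def f prod_eq_iff case_prod_unfold)
  then show "B \<in> orbit A" using f(1) by (auto simp: orbit_def)
next
  assume "B \<in> orbit A"
  then obtain f where f: "f \<in> GL_V" "B = act f A" by (auto simp: orbit_def)
  then have "inv f (f x) = x" for x
    by (auto simp: GL_V_def bij_def)
  then show "isomorphic A B"
    unfolding isomorphic_def case_prod_unfold using f
    by (intro bexI[of _ f]) (simp_all add: act_def case_prod_unfold)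
qed

lemma isomorphic_sym: "isomorphic A B \<Longrightarrow> isomorphic B A"
proof -
  assume "isomorphic A B"
  then obtain f where f: "f \<in> GL_V" "\<And>x y. f (fst A x y) = fst B (f x) (f y)"
    "\<And>x y. f (snd A x y) = snd B (f x) (f y)"
    by (auto simp: isomorphic_def case_prod_unfold)
  have 1: "f (inv f x) = x" for x
    using f(1) by (auto simp: GL_V_def bij_def surj_f_inv_f)
  have 2: "inv f (f x) = x" for x
    using f(1) by (auto simp: GL_V_def bij_def)
  have "inv f (fst B x y) = fst A (inv f x) (inv f y)" "inv f (snd B x y) = snd A (inv f x) (inv f y)" for x y
    using arg_cong[OF f(2)[of "inv f x" "inv f y"], of "inv f"]
      arg_cong[OF f(3)[of "inv f x" "inv f y"], of "inv f"] by (simp_all add: 1 2)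
  then show ?thesis
    unfolding isomorphic_def case_prod_unfold using GL_V_inv[OF f(1)]
    by (intro bexI[of _ "inv f"]) simp_all
qed

lemma isomorphic_refl: "isomorphic A A"
proof -
  have "lin 1 0 0 1 \<in> GL_V" by (intro lin_GL) simp
  moreover have "lin 1 0 0 1 x = x" for x by (simp add: vec2_eq_iff)
  ultimately show ?thesis
    unfolding isomorphic_def case_prod_unfold by (intro bexI[of _ "lin 1 0 0 1"]) simp_all
qed

lemma transposed_Leibniz_Poisson_alg: "transposed_Leibniz_Poisson (alg t)"
  by (cases t) (simp_all add: transposed_Leibniz_Poisson_def vec2_eq_iff algebra_simps)

section \<open>Degenerations\<close>

lemma closure_of_zariski:
  assumes "S \<subseteq> Bil2"
  shows "A \<in> zariski closure_of S \<longleftrightarrow>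
    A \<in> Bil2 \<and> (\<forall>p. polynomial_fun p \<and> (\<forall>B\<in>S. p B = 0) \<longrightarrow> p A = 0)"
proof (intro iffI conjI allI impI)
  assume A: "A \<in> zariski closure_of S"
  then show "A \<in> Bil2"
    using closure_of_subset_topspace[of zariski S] by (auto simp: topspace_zariski)
  fix p assume p: "polynomial_fun p \<and> (\<forall>B\<in>S. p B = 0)"
  then have "closedin zariski (zero_locus {p})"
    unfolding closedin_zariski by (intro exI[of _ "{p}"]) auto
  moreover have "S \<subseteq> zero_locus {p}"
    using p assms by (auto simp: zero_locus_def)
  ultimately have "zariski closure_of S \<subseteq> zero_locus {p}"
    by (intro closure_of_minimal)
  then show "p A = 0"
    using A by (auto simp: zero_locus_def)
next
  assume A: "A \<in> Bil2 \<and> (\<forall>p. polynomial_fun p \<and> (\<forall>B\<in>S. p B = 0) \<longrightarrow> p A = 0)"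
  obtain P where P: "P \<subseteq> Collect polynomial_fun" "zariski closure_of S = zero_locus P"
    using closedin_closure_of[of zariski S] unfolding closedin_zariski by blast
  have "S \<subseteq> zero_locus P"
    using closure_of_subset[of S zariski] assms P(2) by (simp add: topspace_zariski)
  then have "p A = 0" if "p \<in> P" for p
    using A P(1) that unfolding zero_locus_def by blast
  then show "A \<in> zariski closure_of S"
    unfolding P(2) using A by (auto simp: zero_locus_def)
qed

definition continuous_family :: "(complex \<Rightarrow> bracket_pair) \<Rightarrow> bool" where
  "continuous_family B \<longleftrightarrow>
     (\<forall>i j k. isCont (\<lambda>s. fst (B s) (axis i 1) (axis j 1) $ k) 0) \<and>
     (\<forall>i j k. isCont (\<lambda>s. snd (B s) (axis i 1) (axis j 1) $ k) 0)"

lemma isCont_polynomial_fun: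
  "polynomial_fun p \<Longrightarrow> continuous_family B \<Longrightarrow> isCont (\<lambda>s. p (B s)) 0"
  by (induction rule: polynomial_fun.induct) (auto simp: continuous_family_def)

text \<open>A polynomial that vanishes on the orbit vanishes along the family for
  \<open>s \<noteq> 0\<close>, and by continuity also at \<open>s = 0\<close>. So limits in the
  ordinary topology lie in the Zariski closure.\<close>

lemma degenerates_to_limit:
  assumes "continuous_family B" "\<And>s. s \<noteq> 0 \<Longrightarrow> isomorphic (B s) A" "A \<in> Bil2" "B 0 \<in> Bil2"
  shows "degenerates_to A (B 0)"
proof -
  have orb: "B s \<in> orbit A" if "s \<noteq> 0" for s
    using assms(2)[OF that] isomorphic_sym isomorphic_iff_orbit by blast
  have "p (B 0) = 0" if p: "polynomial_fun p" "\<forall>C\<in>orbit A. p C = 0" for p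
  proof -
    have "((\<lambda>s. p (B s)) \<longlongrightarrow> p (B 0)) (at 0)"
      using isCont_polynomial_fun[OF p(1) assms(1)] by (simp add: isCont_def)
    moreover have "((\<lambda>s. p (B s)) \<longlongrightarrow> 0) (at 0)"
    proof (rule tendsto_eventually)
      show "\<forall>\<^sub>F s in at 0. p (B s) = 0"
        using p(2) orb by (auto simp: eventually_at_filter)
    qed
    ultimately show ?thesis
      using tendsto_unique[of "at (0::complex)"] by auto
  qed
  then have "B 0 \<in> zariski closure_of orbit A"
    using closure_of_zariski[OF orbit_Bil2[OF assms(3)]] assms(4) by blast
  then show ?thesis
    unfolding degenerates_to_def using isomorphic_refl by blast
qed

lemma continuous_family_bil:
  assumes "\<And>k. isCont (\<lambda>s. p11 s $ k) 0" "\<And>k. isCont (\<lambda>s. p12 s $ k) 0"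
    "\<And>k. isCont (\<lambda>s. p21 s $ k) 0" "\<And>k. isCont (\<lambda>s. p22 s $ k) 0"
    "\<And>k. isCont (\<lambda>s. q11 s $ k) 0" "\<And>k. isCont (\<lambda>s. q12 s $ k) 0"
    "\<And>k. isCont (\<lambda>s. q21 s $ k) 0" "\<And>k. isCont (\<lambda>s. q22 s $ k) 0"
  shows "continuous_family (\<lambda>s. (bil (p11 s) (p12 s) (p21 s) (p22 s), bil (q11 s) (q12 s) (q21 s) (q22 s)))"
proof -
  note basis = bil_basis[folded axis_eq_e1 axis_eq_e2]
  have "isCont (\<lambda>s. bil (p11 s) (p12 s) (p21 s) (p22 s) (axis i 1) (axis j 1) $ k) 0"
    "isCont (\<lambda>s. bil (q11 s) (q12 s) (q21 s) (q22 s) (axis i 1) (axis j 1) $ k) 0" for i j k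
    using exhaust_2[of i] exhaust_2[of j] by (elim disjE; simp only: basis assms)+
  then show ?thesis
    unfolding continuous_family_def fst_conv snd_conv by blast
qed

lemma bil_hom_if_basis:
  assumes "complex_bilinear m" "Vector_Spaces.linear (*s) (*s) f"
    and "f p11 = m (f e1) (f e1)" "f p12 = m (f e1) (f e2)"
      "f p21 = m (f e2) (f e1)" "f p22 = m (f e2) (f e2)"
  shows "f (bil p11 p12 p21 p22 x y) = m (f x) (f y)"
proof -
  have 1: "complex_bilinear (\<lambda>x y. f (bil p11 p12 p21 p22 x y))"
    using complex_bilinear_bil[of p11 p12 p21 p22] assms(2)
    unfolding complex_bilinear_iff complex_linear_iff by simp
  have 2: "complex_bilinear (\<lambda>x y. m (f x) (f y))"
    using assms(1,2) unfolding complex_bilinear_iff complex_linear_iff by simp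
  show ?thesis
    using fun_cong[OF fun_cong[OF complex_bilinear_eq_bil[OF 1]], of x y]
      fun_cong[OF fun_cong[OF complex_bilinear_eq_bil[OF 2]], of x y]
    by (simp only: bil_basis assms(3-6))
qed

text \<open>\<open>g s\<close> maps the family to \<open>alg t\<close>, so its columns E1, E2 form a
  basis of \<open>alg t\<close>, and \<open>p11 s\<close>, ..., \<open>q22 s\<close> are the
  products of this basis expressed in the basis itself. In the instantiations below the matrix
  entries come in their order of occurrence \<open>a\<close>, \<open>d\<close>, \<open>b\<close>,
  \<open>c\<close>.\<close>

lemma degenerates_to_bil_limit:
  fixes p11 p12 p21 p22 q11 q12 q21 q22 :: "complex \<Rightarrow> V" and a b c d :: "complex \<Rightarrow> complex"
  defines "g \<equiv> \<lambda>s. lin (a s) (b s) (c s) (d s)"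
  assumes cont: "\<And>k. isCont (\<lambda>s. p11 s $ k) 0" "\<And>k. isCont (\<lambda>s. p12 s $ k) 0"
    "\<And>k. isCont (\<lambda>s. p21 s $ k) 0" "\<And>k. isCont (\<lambda>s. p22 s $ k) 0"
    "\<And>k. isCont (\<lambda>s. q11 s $ k) 0" "\<And>k. isCont (\<lambda>s. q12 s $ k) 0"
    "\<And>k. isCont (\<lambda>s. q21 s $ k) 0" "\<And>k. isCont (\<lambda>s. q22 s $ k) 0"
    and alg: "alg t' = (bil (p11 0) (p12 0) (p21 0) (p22 0), bil (q11 0) (q12 0) (q21 0) (q22 0))"
    and det: "\<And>s. s \<noteq> 0 \<Longrightarrow> a s * d s - b s * c s \<noteq> 0"
    and hom1: "\<And>s. s \<noteq> 0 \<Longrightarrow> g s (p11 s) = fst (alg t) (g s e1) (g s e1)"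
      "\<And>s. s \<noteq> 0 \<Longrightarrow> g s (p12 s) = fst (alg t) (g s e1) (g s e2)"
      "\<And>s. s \<noteq> 0 \<Longrightarrow> g s (p21 s) = fst (alg t) (g s e2) (g s e1)"
      "\<And>s. s \<noteq> 0 \<Longrightarrow> g s (p22 s) = fst (alg t) (g s e2) (g s e2)"
    and hom2: "\<And>s. s \<noteq> 0 \<Longrightarrow> g s (q11 s) = snd (alg t) (g s e1) (g s e1)"
      "\<And>s. s \<noteq> 0 \<Longrightarrow> g s (q12 s) = snd (alg t) (g s e1) (g s e2)"
      "\<And>s. s \<noteq> 0 \<Longrightarrow> g s (q21 s) = snd (alg t) (g s e2) (g s e1)"
      "\<And>s. s \<noteq> 0 \<Longrightarrow> g s (q22 s) = snd (alg t) (g s e2) (g s e2)"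
  shows "degenerates_to (alg t) (alg t')"
  unfolding alg
proof (rule degenerates_to_limit[OF continuous_family_bil[OF cont]])
  show "alg t \<in> Bil2" by (rule alg_Bil2)
next
  fix s :: complex assume s: "s \<noteq> 0"
  have g: "g s \<in> GL_V"
    unfolding g_def by (rule lin_GL[OF det[OF s]])
  have bil: "complex_bilinear (fst (alg t))" "complex_bilinear (snd (alg t))"
    using alg_Bil2[of t] by (auto simp: Bil2_def)
  have "Vector_Spaces.linear (*s) (*s) (g s)"
    using g by (simp add: GL_V_def)
  from bil_hom_if_basis[OF bil(1) this hom1[OF s]] bil_hom_if_basis[OF bil(2) this hom2[OF s]]
  show "isomorphic (bil (p11 s) (p12 s) (p21 s) (p22 s), bil (q11 s) (q12 s) (q21 s) (q22 s)) (alg t)"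
    unfolding isomorphic_def case_prod_unfold fst_conv snd_conv
    using g by blast
qed (simp_all add: Bil2_def)

text \<open>Multiplication by \<open>s\<close> is an isomorphism from \<open>alg t\<close> with both
  operations scaled by \<open>s\<close> to \<open>alg t\<close>: the operations are quadratic in the
  arguments together and their values scale linearly.\<close>

lemma degenerates_to_zero: "degenerates_to (alg t) (alg Zero)"
proof -
  define B where "B s = (\<lambda>x y. s *s fst (alg t) x y, \<lambda>x y. s *s snd (alg t) x y)" for s
  have B0: "alg Zero = B 0"
    by (auto simp: B_def fun_eq_iff vec2_eq_iff)
  have bil: "complex_bilinear (fst (alg t))" "complex_bilinear (snd (alg t))"
    using alg_Bil2[of t] by (auto simp: Bil2_def)
  show ?thesis
    unfolding B0
  proof (rule degenerates_to_limit[OF _ _ alg_Bil2])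
    show "continuous_family B"
      by (auto simp: continuous_family_def B_def intro!: continuous_intros)
    show "B 0 \<in> Bil2" using B0 alg_Bil2 by metis
  next
    fix s :: complex assume s: "s \<noteq> 0"
    have "lin s 0 0 s x = s *s x" for x by (simp add: vec2_eq_iff)
    moreover have "lin s 0 0 s \<in> GL_V" using s by (intro lin_GL) simp
    ultimately show "isomorphic (B s) (alg t)"
      unfolding isomorphic_def case_prod_unfold B_def using bil
      by (intro bexI[of _ "lin s 0 0 s"]) (auto simp: complex_bilinear_iff)
  qed
qed

section \<open>Explicit families for the degenerations\<close>

lemma T3_degenerates_to_T5: "degenerates_to (alg T3) (alg (T5 0))"
  by (rule degenerates_to_bil_limit[of "\<lambda>s. e1" "\<lambda>s. e2" "\<lambda>s. e2" "\<lambda>s. s *s e2"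
        "\<lambda>s. 0" "\<lambda>s. 0" "\<lambda>s. 0" "\<lambda>s. 0" _ "\<lambda>s. 1" "\<lambda>s. s" "\<lambda>s. 0" "\<lambda>s. 1"])
    (simp_all add: vec2_eq_iff power2_eq_square divide_simps)

lemma T3_degenerates_to_T6: "degenerates_to (alg T3) (alg T6)"
  by (rule degenerates_to_bil_limit[of "\<lambda>s. e1" "\<lambda>s. 0" "\<lambda>s. 0" "\<lambda>s. s *s e2"
        "\<lambda>s. 0" "\<lambda>s. 0" "\<lambda>s. 0" "\<lambda>s. 0" _ "\<lambda>s. 1" "\<lambda>s. s" "\<lambda>s. 0" "\<lambda>s. 0"])
    (simp_all add: vec2_eq_iff power2_eq_square divide_simps)

text \<open>A composite of two basic degenerations, given here by a family of its own. The basis is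
  E1 = s e1 + 2 s e2 and E2 = E1 E1 - s E1, so that E1 E1 tends to E2; the families from
  \<open>T4\<close>, \<open>T5\<close> and \<open>T6\<close> to \<open>T7\<close> follow the same
  pattern.\<close>

lemma T3_degenerates_to_T7: "degenerates_to (alg T3) (alg (T7 0))"
  by (rule degenerates_to_bil_limit[of "\<lambda>s. s *s e1 + e2" "\<lambda>s. (2 * s) *s e2" "\<lambda>s. (2 * s) *s e2"
        "\<lambda>s. (2 * s\<^sup>2) *s e2" "\<lambda>s. 0" "\<lambda>s. 0" "\<lambda>s. 0" "\<lambda>s. 0" _
        "\<lambda>s. s" "\<lambda>s. 2 * s\<^sup>2" "\<lambda>s. 0" "\<lambda>s. 2 * s"])
    (simp_all add: vec2_eq_iff power2_eq_square divide_simps)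

lemma T4_degenerates_to_T5: "degenerates_to (alg T4) (alg (T5 0))"
  by (rule degenerates_to_bil_limit[of "\<lambda>s. e1" "\<lambda>s. e2" "\<lambda>s. e2" "\<lambda>s. 0"
        "\<lambda>s. s *s e2" "\<lambda>s. 0" "\<lambda>s. 0" "\<lambda>s. 0" _ "\<lambda>s. 1" "\<lambda>s. 1 / s" "\<lambda>s. 0" "\<lambda>s. 0"])
    (simp_all add: vec2_eq_iff power2_eq_square divide_simps)

lemma T4_degenerates_to_T1: "degenerates_to (alg T4) (alg T1)"
  by (rule degenerates_to_bil_limit[of "\<lambda>s. s *s e1" "\<lambda>s. s *s e2" "\<lambda>s. s *s e2" "\<lambda>s. 0"
        "\<lambda>s. e2" "\<lambda>s. 0" "\<lambda>s. 0" "\<lambda>s. 0" _ "\<lambda>s. s" "\<lambda>s. s\<^sup>2" "\<lambda>s. 0" "\<lambda>s. 0"])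
    (simp_all add: vec2_eq_iff power2_eq_square divide_simps)

text \<open>With E1 = s e1 + u e2 one finds E2 = E1 E1 - s E1 = s u e2 and [E1, E1] = s^2 e2. For
  \<open>\<alpha> \<noteq> 0\<close> the choice u = s / alpha makes the bracket exactly alpha E2;
  for \<open>\<alpha> = 0\<close> the choice u = 1 makes it s E2, which tends to 0.\<close>

lemma T4_degenerates_to_T7: "degenerates_to (alg T4) (alg (T7 \<alpha>))"
proof (cases "\<alpha> = 0")
  case True
  show ?thesis
    by (rule degenerates_to_bil_limit[of "\<lambda>s. s *s e1 + e2" "\<lambda>s. s *s e2" "\<lambda>s. s *s e2" "\<lambda>s. 0"
          "\<lambda>s. s *s e2" "\<lambda>s. 0" "\<lambda>s. 0" "\<lambda>s. 0" _ "\<lambda>s. s" "\<lambda>s. s" "\<lambda>s. 0" "\<lambda>s. 1"])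
      (simp_all add: vec2_eq_iff power2_eq_square True)
next
  case False
  then show ?thesis
    by (intro degenerates_to_bil_limit[of "\<lambda>s. s *s e1 + e2" "\<lambda>s. s *s e2" "\<lambda>s. s *s e2" "\<lambda>s. 0"
          "\<lambda>s. \<alpha> *s e2" "\<lambda>s. 0" "\<lambda>s. 0" "\<lambda>s. 0" _ "\<lambda>s. s" "\<lambda>s. s\<^sup>2 / \<alpha>" "\<lambda>s. 0" "\<lambda>s. s / \<alpha>"])
      (simp_all add: vec2_eq_iff power2_eq_square divide_simps)
qed

lemma T5_degenerates_to_T7: "degenerates_to (alg (T5 \<beta>)) (alg (T7 0))"
  by (rule degenerates_to_bil_limit[of "\<lambda>s. s *s e1 + e2" "\<lambda>s. s *s e2" "\<lambda>s. s *s e2" "\<lambda>s. 0"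
        "\<lambda>s. 0" "\<lambda>s. (s * \<beta>) *s e2" "\<lambda>s. - ((s * \<beta>) *s e2)" "\<lambda>s. 0" _
        "\<lambda>s. s" "\<lambda>s. s\<^sup>2" "\<lambda>s. 0" "\<lambda>s. s"])
    (simp_all add: vec2_eq_iff power2_eq_square divide_simps)

lemma T6_degenerates_to_T7: "degenerates_to (alg T6) (alg (T7 0))"
  by (rule degenerates_to_bil_limit[of "\<lambda>s. s *s e1 + e2" "\<lambda>s. 0" "\<lambda>s. 0" "\<lambda>s. 0"
        "\<lambda>s. 0" "\<lambda>s. 0" "\<lambda>s. 0" "\<lambda>s. 0" _ "\<lambda>s. s" "\<lambda>s. - s" "\<lambda>s. 0" "\<lambda>s. 1"])
    (simp_all add: vec2_eq_iff power2_eq_square divide_simps)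

lemma T8_degenerates_to_T7: "degenerates_to (alg T8) (alg (T7 0))"
  by (rule degenerates_to_bil_limit[of "\<lambda>s. e2" "\<lambda>s. 0" "\<lambda>s. 0" "\<lambda>s. 0"
        "\<lambda>s. 0" "\<lambda>s. s *s e2" "\<lambda>s. - (s *s e2)" "\<lambda>s. 0" _ "\<lambda>s. s" "\<lambda>s. s\<^sup>2" "\<lambda>s. 0" "\<lambda>s. 0"])
    (simp_all add: vec2_eq_iff power2_eq_square divide_simps)

lemma T8_degenerates_to_T2: "degenerates_to (alg T8) (alg T2)"
  by (rule degenerates_to_bil_limit[of "\<lambda>s. s *s e2" "\<lambda>s. 0" "\<lambda>s. 0" "\<lambda>s. 0"
        "\<lambda>s. 0" "\<lambda>s. e2" "\<lambda>s. - e2" "\<lambda>s. 0" _ "\<lambda>s. 1" "\<lambda>s. 1 / s" "\<lambda>s. 0" "\<lambda>s. 0"])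
    (simp_all add: vec2_eq_iff power2_eq_square divide_simps)


section \<open>Closed invariants\<close>

text \<open>Agreement is asked for on \<open>Bil2\<close> because the value of an operation at
  arbitrary vectors is polynomial in the structure constants by bilinearity.\<close>

definition regular :: "(bracket_pair \<Rightarrow> complex) \<Rightarrow> bool" where
  "regular f \<longleftrightarrow> (\<exists>p. polynomial_fun p \<and> (\<forall>A\<in>Bil2. f A = p A))"

definition regular_vec :: "(bracket_pair \<Rightarrow> V) \<Rightarrow> bool" where
  "regular_vec u \<longleftrightarrow> (\<forall>k. regular (\<lambda>A. u A $ k))"

lemma regular_const: "regular (\<lambda>_. c)"
  unfolding regular_def using polynomial_fun.const by blast

lemma regular_add:
  assumes "regular f" "regular g" shows "regular (\<lambda>A. f A + g A)"
proof -
  obtain p q where "polynomial_fun p" "\<forall>A\<in>Bil2. f A = p A" "polynomial_fun q" "\<forall>A\<in>Bil2. g A = q A"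
    using assms unfolding regular_def by blast
  then show ?thesis
    unfolding regular_def by (intro exI[of _ "\<lambda>A. p A + q A"]) (auto intro: polynomial_fun.add)
qed

lemma regular_mult:
  assumes "regular f" "regular g" shows "regular (\<lambda>A. f A * g A)"
proof -
  obtain p q where "polynomial_fun p" "\<forall>A\<in>Bil2. f A = p A" "polynomial_fun q" "\<forall>A\<in>Bil2. g A = q A"
    using assms unfolding regular_def by blast
  then show ?thesis
    unfolding regular_def by (intro exI[of _ "\<lambda>A. p A * q A"]) (auto intro: polynomial_fun.mult)
qed

lemma regular_diff:
  assumes "regular f" "regular g" shows "regular (\<lambda>A. f A - g A)"
  using regular_add[OF assms(1) regular_mult[OF regular_const[of "-1"] assms(2)]] by simp

lemma regular_power2: "regular f \<Longrightarrow> regular (\<lambda>A. (f A)\<^sup>2)"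
  unfolding power2_eq_square by (rule regular_mult)

lemma regular_vec_const: "regular_vec (\<lambda>_. x)"
  unfolding regular_vec_def by (simp add: regular_const)

lemma regular_nth: "regular_vec u \<Longrightarrow> regular (\<lambda>A. u A $ k)"
  unfolding regular_vec_def by blast

lemma regular_cong: "regular f \<Longrightarrow> (\<And>A. A \<in> Bil2 \<Longrightarrow> f A = g A) \<Longrightarrow> regular g"
  unfolding regular_def by metis

lemma regular_vec_fst:
  assumes "regular_vec u" "regular_vec w"
  shows "regular_vec (\<lambda>A. fst A (u A) (w A))"
  unfolding regular_vec_def
proof
  fix k
  have c: "regular (\<lambda>A. fst A (axis i 1) (axis j 1) $ k)" for i j
    unfolding regular_def using polynomial_fun.coord_fst by blast
  have "regular (\<lambda>A. bil (fst A e1 e1) (fst A e1 e2) (fst A e2 e1) (fst A e2 e2) (u A) (w A) $ k)"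
    unfolding bil_nth e1_def e2_def
    by (intro regular_add regular_mult regular_nth assms c)
  then show "regular (\<lambda>A. fst A (u A) (w A) $ k)"
  proof (rule regular_cong)
    fix A assume "A \<in> Bil2"
    then have "complex_bilinear (fst A)" by (auto simp: Bil2_def)
    from fun_cong[OF fun_cong[OF complex_bilinear_eq_bil[OF this]], of "u A" "w A"]
    show "bil (fst A e1 e1) (fst A e1 e2) (fst A e2 e1) (fst A e2 e2) (u A) (w A) $ k =
        fst A (u A) (w A) $ k" by simp
  qed
qed

lemma regular_vec_snd:
  assumes "regular_vec u" "regular_vec w"
  shows "regular_vec (\<lambda>A. snd A (u A) (w A))"
  unfolding regular_vec_def
proof
  fix k
  have c: "regular (\<lambda>A. snd A (axis i 1) (axis j 1) $ k)" for i j
    unfolding regular_def using polynomial_fun.coord_snd by blast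
  have "regular (\<lambda>A. bil (snd A e1 e1) (snd A e1 e2) (snd A e2 e1) (snd A e2 e2) (u A) (w A) $ k)"
    unfolding bil_nth e1_def e2_def
    by (intro regular_add regular_mult regular_nth assms c)
  then show "regular (\<lambda>A. snd A (u A) (w A) $ k)"
  proof (rule regular_cong)
    fix A assume "A \<in> Bil2"
    then have "complex_bilinear (snd A)" by (auto simp: Bil2_def)
    from fun_cong[OF fun_cong[OF complex_bilinear_eq_bil[OF this]], of "u A" "w A"]
    show "bil (snd A e1 e1) (snd A e1 e2) (snd A e2 e1) (snd A e2 e2) (u A) (w A) $ k =
        snd A (u A) (w A) $ k" by simp
  qed
qed

definition det2 :: "V \<Rightarrow> V \<Rightarrow> complex" where
  "det2 x y = x$1 * y$2 - x$2 * y$1"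

lemma regular_det2: "regular_vec u \<Longrightarrow> regular_vec w \<Longrightarrow> regular (\<lambda>A. det2 (u A) (w A))"
  unfolding det2_def by (intro regular_diff regular_mult regular_nth)

lemmas regular_intros = regular_add regular_diff regular_mult regular_power2 regular_det2
  regular_nth regular_vec_fst regular_vec_snd regular_vec_const regular_const

definition closed_invariant :: "(bracket_pair \<Rightarrow> bool) \<Rightarrow> bool" where
  "closed_invariant P \<longleftrightarrow> (\<exists>F. (\<forall>f\<in>F. regular f) \<and> (\<forall>A\<in>Bil2. P A \<longleftrightarrow> (\<forall>f\<in>F. f A = 0))) \<and>
     (\<forall>A B. isomorphic A B \<longrightarrow> P A \<longrightarrow> P B)"

text \<open>An isomorphism \<open>h\<close> carries the equations at \<open>x\<close>,
  \<open>y\<close>, \<open>z\<close> to those at the image vectors, and these exhaust all vectors by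
  surjectivity. The scalar \<open>\<delta>\<close> is the determinant of \<open>h\<close>; it enters
  the conditions on traces and determinants.\<close>

lemma closed_invariantI:
  fixes f :: "V \<Rightarrow> V \<Rightarrow> V \<Rightarrow> 2 \<Rightarrow> bracket_pair \<Rightarrow> complex"
  assumes "\<And>x y z k. regular (f x y z k)" "\<And>A. P A \<longleftrightarrow> (\<forall>x y z k. f x y z k A = 0)"
    and "\<And>A B h \<delta>. P A \<Longrightarrow> h 0 = 0 \<Longrightarrow> (\<And>c x. h (c *s x) = c *s h x) \<Longrightarrow>
      (\<And>x y. fst B (h x) (h y) = h (fst A x y)) \<Longrightarrow> (\<And>x y. snd B (h x) (h y) = h (snd A x y)) \<Longrightarrow>
      (\<And>x y. det2 (h x) (h y) = \<delta> * det2 x y) \<Longrightarrow> (\<And>x y z k. f (h x) (h y) (h z) k B = 0)"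
  shows "closed_invariant P"
  unfolding closed_invariant_def
proof (intro conjI allI impI)
  show "\<exists>F. (\<forall>f\<in>F. regular f) \<and> (\<forall>A\<in>Bil2. P A \<longleftrightarrow> (\<forall>f\<in>F. f A = 0))"
    using assms(1,2) by (intro exI[of _ "{f x y z k |x y z k. True}"]) blast
  fix A B assume iso: "isomorphic A B" and "P A"
  obtain h where h: "h \<in> GL_V" "\<And>x y. fst B (h x) (h y) = h (fst A x y)"
    "\<And>x y. snd B (h x) (h y) = h (snd A x y)"
    using iso unfolding isomorphic_def case_prod_unfold by metis
  obtain a b c d where abcd: "h = lin a b c d"
    using h(1) by (rule GL_V_cases)
  have det: "det2 (h x) (h y) = (a * d - b * c) * det2 x y" for x y
    by (simp add: abcd det2_def algebra_simps)
  have scale: "h (c *s x) = c *s h x" for c x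
    using h(1) by (auto simp: GL_V_def complex_linear_iff)
  have "h 0 = 0" using scale[of 0 0] by simp
  note 0 = assms(3)[OF \<open>P A\<close> this scale h(2,3) det]
  have "surj h"
    using h(1) by (auto simp: GL_V_def bij_def)
  show "P B"
    unfolding assms(2)
  proof (intro allI)
    fix x y z k
    have "f (h (inv h x)) (h (inv h y)) (h (inv h z)) k B = 0" by (rule 0)
    then show "f x y z k B = 0"
      using \<open>surj h\<close> by (simp add: surj_f_inv_f)
  qed
qed

lemma degenerates_to_closed_invariant:
  assumes "closed_invariant P" "degenerates_to A B" "A \<in> Bil2" "P A"
  shows "P B"
proof -
  obtain F where F: "\<forall>f\<in>F. regular f" "\<forall>A\<in>Bil2. P A \<longleftrightarrow> (\<forall>f\<in>F. f A = 0)"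
    using assms(1) unfolding closed_invariant_def by blast
  have inv: "isomorphic A B \<Longrightarrow> P A \<Longrightarrow> P B" for A B
    using assms(1) unfolding closed_invariant_def by blast
  obtain B' where B': "isomorphic B B'" "B' \<in> zariski closure_of (orbit A)"
    using assms(2) unfolding degenerates_to_def by blast
  note closure = B'(2)[unfolded closure_of_zariski[OF orbit_Bil2[OF assms(3)]]]
  have "f B' = 0" if "f \<in> F" for f
  proof -
    obtain p where p: "polynomial_fun p" "\<forall>A\<in>Bil2. f A = p A"
      using F(1) \<open>f \<in> F\<close> unfolding regular_def by blast
    have "p C = 0" if "C \<in> orbit A" for C
    proof -
      have "P C" using that inv[of A C] assms(4) isomorphic_iff_orbit by blast
      moreover have "C \<in> Bil2" using that orbit_Bil2[OF assms(3)] by blast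
      ultimately show ?thesis using F(2) p(2) \<open>f \<in> F\<close> by auto
    qed
    then show ?thesis using closure p by auto
  qed
  then have "P B'" using F(2) closure by blast
  then show ?thesis using inv isomorphic_sym[OF B'(1)] by blast
qed

section \<open>The invariant conditions that exclude degenerations\<close>

definition bracket_symmetric :: "bracket_pair \<Rightarrow> bool" where
  "bracket_symmetric A \<longleftrightarrow> (\<forall>x y. snd A x y = snd A y x)"

definition bracket_alternating :: "bracket_pair \<Rightarrow> bool" where
  "bracket_alternating A \<longleftrightarrow> (\<forall>x. snd A x x = 0)"

definition product_zero :: "bracket_pair \<Rightarrow> bool" where
  "product_zero A \<longleftrightarrow> (\<forall>x y. fst A x y = 0)"

definition product_nilpotent :: "bracket_pair \<Rightarrow> bool" where
  "product_nilpotent A \<longleftrightarrow> (\<forall>x y z. fst A (fst A x y) z = 0)"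

text \<open>For \<open>\<alpha> = 0\<close> this is the vanishing of the bracket; in general it
  tells the members of the family \<open>T7\<close> apart.\<close>

definition bracket_multiple :: "complex \<Rightarrow> bracket_pair \<Rightarrow> bool" where
  "bracket_multiple \<alpha> A \<longleftrightarrow> (\<forall>x y. snd A x y = \<alpha> *s fst A x y)"

text \<open>The trace and the determinant of a linear map \<open>h\<close> are the factors in
  \<open>det2 (h y) z + det2 y (h z) = tr h * det2 y z\<close> and \<open>det2 (h y) (h z) = det h * det2 y z\<close>.
  The next three properties say \<open>2 tr ad x = \<beta> tr L x\<close>, \<open>(tr L x)\<^sup>2 = 4 det L x\<close> and
  \<open>det L x = 0\<close>, where \<open>L x\<close> is the multiplication by \<open>x\<close>.\<close>

definition trace_ratio :: "complex \<Rightarrow> bracket_pair \<Rightarrow> bool" where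
  "trace_ratio \<beta> A \<longleftrightarrow> (\<forall>x y z. 2 * (det2 (snd A x y) z + det2 y (snd A x z)) =
     \<beta> * (det2 (fst A x y) z + det2 y (fst A x z)))"

definition product_unipotent :: "bracket_pair \<Rightarrow> bool" where
  "product_unipotent A \<longleftrightarrow> (\<forall>x y z. (det2 (fst A x y) z + det2 y (fst A x z))\<^sup>2 =
     4 * det2 (fst A x y) (fst A x z) * det2 y z)"

definition product_singular :: "bracket_pair \<Rightarrow> bool" where
  "product_singular A \<longleftrightarrow> (\<forall>x y z. det2 (fst A x y) (fst A x z) = 0)"

lemma closed_invariant_bracket_symmetric: "closed_invariant bracket_symmetric"
proof (rule closed_invariantI[where f = "\<lambda>x y z k A. snd A x y $ k - snd A y x $ k"])
  show "bracket_symmetric A \<longleftrightarrow> (\<forall>x y z k. snd A x y $ k - snd A y x $ k = 0)" for A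
    by (simp add: bracket_symmetric_def vec_eq_iff)
qed (intro regular_intros, simp add: bracket_symmetric_def)

lemma closed_invariant_bracket_alternating: "closed_invariant bracket_alternating"
proof (rule closed_invariantI[where f = "\<lambda>x y z k A. snd A x x $ k"])
  show "bracket_alternating A \<longleftrightarrow> (\<forall>x y z k. snd A x x $ k = 0)" for A
    by (simp add: bracket_alternating_def vec_eq_iff)
qed (intro regular_intros, simp add: bracket_alternating_def)

lemma closed_invariant_product_zero: "closed_invariant product_zero"
proof (rule closed_invariantI[where f = "\<lambda>x y z k A. fst A x y $ k"])
  show "product_zero A \<longleftrightarrow> (\<forall>x y z k. fst A x y $ k = 0)" for A
    by (simp add: product_zero_def vec_eq_iff)
qed (intro regular_intros, simp add: product_zero_def)

lemma closed_invariant_product_nilpotent: "closed_invariant product_nilpotent"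
proof (rule closed_invariantI[where f = "\<lambda>x y z k A. fst A (fst A x y) z $ k"])
  show "product_nilpotent A \<longleftrightarrow> (\<forall>x y z k. fst A (fst A x y) z $ k = 0)" for A
    by (simp add: product_nilpotent_def vec_eq_iff)
qed (intro regular_intros, simp add: product_nilpotent_def)

lemma closed_invariant_bracket_multiple: "closed_invariant (bracket_multiple \<alpha>)"
proof (rule closed_invariantI[where f = "\<lambda>x y z k A. snd A x y $ k - \<alpha> * fst A x y $ k"])
  show "bracket_multiple \<alpha> A \<longleftrightarrow> (\<forall>x y z k. snd A x y $ k - \<alpha> * fst A x y $ k = 0)" for A
    by (simp add: bracket_multiple_def vec_eq_iff)
qed (intro regular_intros, simp add: bracket_multiple_def)

text \<open>Both sides are linear in \<open>det2\<close>, so an isomorphism multiplies both by its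
  determinant \<open>\<delta>\<close>.\<close>

lemma closed_invariant_trace_ratio: "closed_invariant (trace_ratio \<beta>)"
proof (rule closed_invariantI[where f = "\<lambda>x y z k A.
    2 * (det2 (snd A x y) z + det2 y (snd A x z)) - \<beta> * (det2 (fst A x y) z + det2 y (fst A x z))"])
  fix A B h \<delta> x y z
  assume "trace_ratio \<beta> A" and h: "\<And>x y. fst B (h x) (h y) = h (fst A x y)"
    "\<And>x y. snd B (h x) (h y) = h (snd A x y)" "\<And>x y. det2 (h x) (h y) = \<delta> * det2 x y"
  then have "\<delta> * (2 * (det2 (snd A x y) z + det2 y (snd A x z))) =
      \<delta> * (\<beta> * (det2 (fst A x y) z + det2 y (fst A x z)))"
    by (simp only: trace_ratio_def)
  then show "2 * (det2 (snd B (h x) (h y)) (h z) + det2 (h y) (snd B (h x) (h z))) -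
      \<beta> * (det2 (fst B (h x) (h y)) (h z) + det2 (h y) (fst B (h x) (h z))) = 0"
    unfolding h by (simp add: algebra_simps)
qed (intro regular_intros, simp add: trace_ratio_def)

text \<open>Both sides have degree two in \<open>det2\<close>, so the common factor is the square of
  \<open>\<delta>\<close>.\<close>

lemma closed_invariant_product_unipotent: "closed_invariant product_unipotent"
proof (rule closed_invariantI[where f = "\<lambda>x y z k A.
    (det2 (fst A x y) z + det2 y (fst A x z))\<^sup>2 - 4 * det2 (fst A x y) (fst A x z) * det2 y z"])
  fix A B h \<delta> x y z
  assume "product_unipotent A" and h: "\<And>x y. fst B (h x) (h y) = h (fst A x y)"
    "\<And>x y. det2 (h x) (h y) = \<delta> * det2 x y"
  then have "\<delta>\<^sup>2 * (det2 (fst A x y) z + det2 y (fst A x z))\<^sup>2 =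
      \<delta>\<^sup>2 * (4 * det2 (fst A x y) (fst A x z) * det2 y z)"
    by (simp only: product_unipotent_def)
  then show "(det2 (fst B (h x) (h y)) (h z) + det2 (h y) (fst B (h x) (h z)))\<^sup>2 -
      4 * det2 (fst B (h x) (h y)) (fst B (h x) (h z)) * det2 (h y) (h z) = 0"
    unfolding h distrib_left[symmetric] power_mult_distrib
    by (simp only: power2_eq_square[of \<delta>]) (simp only: mult_ac diff_self)
qed (intro regular_intros, simp add: product_unipotent_def)

lemma closed_invariant_product_singular: "closed_invariant product_singular"
proof (rule closed_invariantI[where f = "\<lambda>x y z k A. det2 (fst A x y) (fst A x z)"])
qed (intro regular_intros, simp_all add: product_singular_def)

lemmas invariant_defs = bracket_symmetric_def bracket_alternating_def product_zero_def
  product_nilpotent_def bracket_multiple_def trace_ratio_def product_unipotent_def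
  product_singular_def

lemma invariants_hold:
  "bracket_symmetric (alg T4)" "bracket_symmetric (alg T1)"
  "bracket_alternating (alg (T5 \<beta>))" "bracket_alternating (alg T8)" "bracket_alternating (alg T2)"
  "product_zero (alg T1)" "product_zero (alg T2)" "product_zero (alg Zero)"
  "product_nilpotent (alg T8)" "product_nilpotent (alg (T7 \<alpha>))"
  "bracket_multiple 0 (alg T3)" "bracket_multiple 0 (alg T6)" "bracket_multiple \<alpha> (alg (T7 \<alpha>))"
  "bracket_multiple 0 (alg Zero)"
  "trace_ratio \<beta> (alg (T5 \<beta>))"
  "product_unipotent (alg T4)" "product_unipotent (alg (T5 \<beta>))"
  "product_singular (alg T6)"
  by (simp_all add: invariant_defs vec2_eq_iff det2_def power2_eq_square algebra_simps)

lemma invariants_fail: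
  "\<not> bracket_symmetric (alg T2)" "\<not> bracket_symmetric (alg T8)"
  "bracket_symmetric (alg (T5 \<gamma>)) \<Longrightarrow> \<gamma> = 0"
  "\<not> bracket_alternating (alg T1)" "\<not> bracket_alternating (alg T4)"
  "bracket_alternating (alg (T7 \<gamma>)) \<Longrightarrow> \<gamma> = 0"
  "\<not> product_zero (alg T3)" "\<not> product_zero (alg T4)" "\<not> product_zero (alg (T5 \<gamma>))"
  "\<not> product_zero (alg T6)" "\<not> product_zero (alg (T7 \<gamma>))" "\<not> product_zero (alg T8)"
  "\<not> product_nilpotent (alg T3)" "\<not> product_nilpotent (alg T4)"
  "\<not> product_nilpotent (alg (T5 \<gamma>))" "\<not> product_nilpotent (alg T6)"
  "\<not> bracket_multiple \<alpha> (alg T1)" "\<not> bracket_multiple \<alpha> (alg T2)" "\<not> bracket_multiple 0 (alg T4)"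
  "bracket_multiple 0 (alg (T5 \<gamma>)) \<Longrightarrow> \<gamma> = 0" "bracket_multiple \<alpha> (alg (T7 \<gamma>)) \<Longrightarrow> \<gamma> = \<alpha>"
  "\<not> bracket_multiple \<alpha> (alg T8)"
  "\<not> trace_ratio \<beta> (alg T2)" "trace_ratio \<beta> (alg (T5 \<gamma>)) \<Longrightarrow> \<gamma> = \<beta>" "\<not> trace_ratio \<beta> (alg T8)"
  "\<not> product_unipotent (alg T3)" "\<not> product_unipotent (alg T6)"
  "\<not> product_singular (alg T3)" "\<not> product_singular (alg (T5 \<gamma>))"
proof -
  have sym: "bracket_symmetric A \<Longrightarrow> snd A e1 e2 $ 2 = snd A e2 e1 $ 2" for A
    by (simp add: bracket_symmetric_def)
  have alt: "bracket_alternating A \<Longrightarrow> snd A e1 e1 $ 2 = 0" for A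
    by (simp add: bracket_alternating_def)
  have zero: "product_zero A \<Longrightarrow> fst A e1 e1 = 0" for A
    by (simp add: product_zero_def)
  have nil: "product_nilpotent A \<Longrightarrow> fst A (fst A e1 e1) e1 $ 1 = 0" for A
    by (simp add: product_nilpotent_def)
  have mult: "bracket_multiple \<alpha> A \<Longrightarrow> snd A e1 e1 $ 2 = \<alpha> * fst A e1 e1 $ 2"
    "bracket_multiple \<alpha> A \<Longrightarrow> snd A e1 e2 $ 2 = \<alpha> * fst A e1 e2 $ 2" for \<alpha> A
    by (simp_all add: bracket_multiple_def)
  have ratio: "trace_ratio \<beta> A \<Longrightarrow> 2 * (det2 (snd A e1 e1) e2 + det2 e1 (snd A e1 e2)) =
      \<beta> * (det2 (fst A e1 e1) e2 + det2 e1 (fst A e1 e2))" for \<beta> A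
    by (simp add: trace_ratio_def)
  have uni: "product_unipotent A \<Longrightarrow> (det2 (fst A e1 e1) e2 + det2 e1 (fst A e1 e2))\<^sup>2 =
      4 * det2 (fst A e1 e1) (fst A e1 e2) * det2 e1 e2" for A
    by (simp add: product_unipotent_def)
  \<comment> \<open>The vector \<open>e1 + e2\<close> is the unit of \<open>T3\<close> and
    multiplies invertibly in \<open>T5\<close> too, whereas multiplication by \<open>e1\<close>
    alone is singular in \<open>T3\<close>.\<close>
  have sing: "product_singular A \<Longrightarrow> det2 (fst A (e1 + e2) e1) (fst A (e1 + e2) e2) = 0" for A
    by (simp add: product_singular_def)
  show "\<not> bracket_symmetric (alg T2)" "\<not> bracket_symmetric (alg T8)"
    "bracket_symmetric (alg (T5 \<gamma>)) \<Longrightarrow> \<gamma> = 0"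
    using sym[of "alg T2"] sym[of "alg T8"] sym[of "alg (T5 \<gamma>)"] by auto
  show "\<not> bracket_alternating (alg T1)" "\<not> bracket_alternating (alg T4)"
    "bracket_alternating (alg (T7 \<gamma>)) \<Longrightarrow> \<gamma> = 0"
    using alt[of "alg T1"] alt[of "alg T4"] alt[of "alg (T7 \<gamma>)"] by auto
  show "\<not> product_zero (alg T3)" "\<not> product_zero (alg T4)" "\<not> product_zero (alg (T5 \<gamma>))"
    "\<not> product_zero (alg T6)" "\<not> product_zero (alg (T7 \<gamma>))" "\<not> product_zero (alg T8)"
    using zero by (fastforce simp: vec2_eq_iff)+
  show "\<not> product_nilpotent (alg T3)" "\<not> product_nilpotent (alg T4)"
    "\<not> product_nilpotent (alg (T5 \<gamma>))" "\<not> product_nilpotent (alg T6)"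
    using nil by fastforce+
  show "\<not> bracket_multiple \<alpha> (alg T1)" "\<not> bracket_multiple \<alpha> (alg T2)"
    "\<not> bracket_multiple 0 (alg T4)" "bracket_multiple 0 (alg (T5 \<gamma>)) \<Longrightarrow> \<gamma> = 0"
    "bracket_multiple \<alpha> (alg (T7 \<gamma>)) \<Longrightarrow> \<gamma> = \<alpha>" "\<not> bracket_multiple \<alpha> (alg T8)"
    using mult by fastforce+
  show "\<not> trace_ratio \<beta> (alg T2)" "trace_ratio \<beta> (alg (T5 \<gamma>)) \<Longrightarrow> \<gamma> = \<beta>"
    "\<not> trace_ratio \<beta> (alg T8)"
    using ratio[of \<beta> "alg T2"] ratio[of \<beta> "alg (T5 \<gamma>)"] ratio[of \<beta> "alg T8"]
    by (auto simp: det2_def)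
  show "\<not> product_unipotent (alg T3)" "\<not> product_unipotent (alg T6)"
    using uni[of "alg T3"] uni[of "alg T6"] by (auto simp: det2_def)
  show "\<not> product_singular (alg T3)" "\<not> product_singular (alg (T5 \<gamma>))"
    using sing[of "alg T3"] sing[of "alg (T5 \<gamma>)"] by (auto simp: det2_def)
qed

text \<open>Apart from chains ending in \<open>Zero\<close>, the only pair that composition adds to
  the basic list is \<open>T3\<close>, \<open>T7 0\<close>; each possibility has its own family
  above.\<close>

lemma basic_degeneration_trancl:
  assumes "basic_degeneration\<^sup>+\<^sup>+ t t'"
  shows "degenerates_to (alg t) (alg t')"
proof -
  from assms have "t' = Zero \<or> basic_degeneration t t' \<or> (t = T3 \<and> t' = T7 0)"
    by (induction rule: tranclp_induct)
      (auto elim!: basic_degeneration.cases intro: basic_degeneration.intros)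
  then show ?thesis
    by (auto elim!: basic_degeneration.cases simp del: alg.simps
        intro: degenerates_to_zero T3_degenerates_to_T5 T3_degenerates_to_T6 T3_degenerates_to_T7 T4_degenerates_to_T5 T4_degenerates_to_T1 T4_degenerates_to_T7 T5_degenerates_to_T7 T6_degenerates_to_T7 T8_degenerates_to_T7 T8_degenerates_to_T2)
qed

lemma degenerates_to_alg_iff:
  "degenerates_to (alg t) (alg t') \<longleftrightarrow> isomorphic (alg t) (alg t') \<or> basic_degeneration\<^sup>+\<^sup>+ t t'"
proof
  assume deg: "degenerates_to (alg t) (alg t')"
  have inv: "P (alg t) \<Longrightarrow> P (alg t')" if "closed_invariant P" for P
    by (rule degenerates_to_closed_invariant[OF that deg alg_Bil2])
  note inv = inv[OF closed_invariant_bracket_symmetric] inv[OF closed_invariant_bracket_alternating]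
    inv[OF closed_invariant_product_zero] inv[OF closed_invariant_product_nilpotent]
    inv[OF closed_invariant_bracket_multiple] inv[OF closed_invariant_trace_ratio]
    inv[OF closed_invariant_product_unipotent] inv[OF closed_invariant_product_singular]
  note fails = invariants_fail(1,2,4,5,7-19,22,23,25-29)
    and eqs = invariants_fail(3,6,20,21,24)
  note basic = basic_degeneration.intros[THEN tranclp.r_into_trancl[where r = basic_degeneration]]
  note zero = tranclp.trancl_into_trancl[where r = basic_degeneration, OF _ basic_degeneration.intros(10)]
    tranclp.trancl_into_trancl[where r = basic_degeneration, OF _ basic_degeneration.intros(11)]
    tranclp.trancl_into_trancl[where r = basic_degeneration, OF _ basic_degeneration.intros(12), of _ 0]
  have chain: "basic_degeneration\<^sup>+\<^sup>+ T3 (T7 0)"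
    by (rule tranclp.trancl_into_trancl[where r = basic_degeneration, OF basic(2) basic_degeneration.intros(7)])
  \<comment> \<open>All the pairs connected by a chain, written out so that each case below closes
    by lookup. \<open>Zero\<close> is reached from \<open>T4\<close> through \<open>T1\<close>, and
    from \<open>T3\<close>, \<open>T5\<close>, \<open>T6\<close> and \<open>T8\<close> through
    \<open>T7 0\<close>.\<close>
  note reach = basic chain zero(1)[OF basic(4)] zero(3)[OF basic(6)] zero(3)[OF basic(7)] zero(3)[OF basic(8)]
    zero(3)[OF chain]
  \<comment> \<open>Isomorphism is sharpened to equality of names. Each case invokes properties of
    the source that every unreachable target other than the source itself violates.\<close>
  have "t = t' \<or> basic_degeneration\<^sup>+\<^sup>+ t t'"
  proof (cases t)
    case T1
    show ?thesis
      using inv(1,3) invariants_hold(2,6) unfolding T1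
      by (cases t') (auto simp: fails simp del: alg.simps intro: reach dest: eqs)
  next
    case T2
    show ?thesis
      using inv(2,3) invariants_hold(5,7) unfolding T2
      by (cases t') (auto simp: fails simp del: alg.simps intro: reach dest: eqs)
  next
    case T3
    show ?thesis
      using inv(5)[of 0] invariants_hold(11) unfolding T3
      by (cases t') (auto simp: fails simp del: alg.simps intro: reach dest: eqs)
  next
    case T4
    show ?thesis
      using inv(1,7) invariants_hold(1,16) unfolding T4
      by (cases t') (auto simp: fails simp del: alg.simps intro: reach dest: eqs)
  next
    case (T5 \<beta>)
    show ?thesis
      using inv(2,7) inv(6)[of \<beta>] invariants_hold(3)[of \<beta>] invariants_hold(15)[of \<beta>]
        invariants_hold(17)[of \<beta>] unfolding T5
      by (cases t') (auto simp: fails simp del: alg.simps intro: reach dest: eqs)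
  next
    case T6
    show ?thesis
      using inv(5)[of 0] inv(8) invariants_hold(12,18) unfolding T6
      by (cases t') (auto simp: fails simp del: alg.simps intro: reach dest: eqs)
  next
    case (T7 \<alpha>)
    show ?thesis
      using inv(4) inv(5)[of \<alpha>] invariants_hold(10)[of \<alpha>] invariants_hold(13)[of \<alpha>] unfolding T7
      by (cases t') (auto simp: fails simp del: alg.simps intro: reach dest: eqs)
  next
    case T8
    show ?thesis
      using inv(2,4) invariants_hold(4,9) unfolding T8
      by (cases t') (auto simp: fails simp del: alg.simps intro: reach dest: eqs)
  next
    case Zero
    show ?thesis
      using inv(3) inv(5)[of 0] invariants_hold(8,14) unfolding Zero
      by (cases t') (auto simp: fails simp del: alg.simps intro: reach dest: eqs)
  qed
  then show "isomorphic (alg t) (alg t') \<or> basic_degeneration\<^sup>+\<^sup>+ t t'"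
    using isomorphic_refl by blast
next
  assume "isomorphic (alg t) (alg t') \<or> basic_degeneration\<^sup>+\<^sup>+ t t'"
  then show "degenerates_to (alg t) (alg t')"
  proof
    assume "isomorphic (alg t) (alg t')"
    then have "alg t' \<in> zariski closure_of orbit (alg t)"
      using closure_of_subset[of "orbit (alg t)" zariski] orbit_Bil2[OF alg_Bil2, of t]
      by (auto simp: isomorphic_iff_orbit topspace_zariski)
    then show ?thesis
      unfolding degenerates_to_def using isomorphic_refl by blast
  qed (rule basic_degeneration_trancl)
qed

section \<open>Dimensions of the orbits\<close>

definition linear_form :: "complex \<Rightarrow> complex \<Rightarrow> V \<Rightarrow> complex" where
  "linear_form f g x = f * x$1 + g * x$2"

text \<open>\<open>h\<close> is the inverse of the matrix and \<open>r\<close> the inverse of its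
  determinant. Both are given by equations, so the identities below are free of division and
  \<open>r\<close> can occur as a parameter.\<close>

definition base_change :: "complex \<Rightarrow> complex \<Rightarrow> complex \<Rightarrow> complex \<Rightarrow> complex \<Rightarrow> complex \<Rightarrow> (V \<Rightarrow> V) \<Rightarrow> bool"
  where "base_change a b c d D r h \<longleftrightarrow>
    a * d - b * c = D \<and> D * r = 1 \<and> (\<forall>x. lin a b c d (h x) = x)"

lemma orbit_coordinates:
  assumes "B \<in> orbit A"
  obtains a b c d D r h where "base_change a b c d D r h"
    "B = (\<lambda>x y. lin a b c d (fst A (h x) (h y)), \<lambda>x y. lin a b c d (snd A (h x) (h y)))"
proof -
  obtain a b c d where D: "a * d - b * c \<noteq> 0" and B: "B = act (lin a b c d) A"
    using assms by (rule orbit_cases)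
  have "lin a b c d (inv (lin a b c d) x) = x" for x
    unfolding inv_lin[OF refl D] by (rule lin_inverse(2)[OF refl D])
  then have "base_change a b c d (a * d - b * c) (1 / (a * d - b * c)) (inv (lin a b c d))"
    using D by (simp add: base_change_def)
  then show ?thesis
    by (rule that) (simp add: B act_def case_prod_unfold)
qed

text \<open>The forms are the rows of the adjugate, that is, Cramer's rule. Their scale
  \<open>s\<close> stays free because it is specialised differently: to \<open>r\<close> for the
  dual basis, to 1, and to a cube root.\<close>

lemma base_change:
  assumes "base_change a b c d D r h"
  shows base_change_D: "a * d - b * c = D" and base_change_r: "D * r = 1"
    and base_change_x: "x $ 1 = a * h x $ 1 + b * h x $ 2" "x $ 2 = c * h x $ 1 + d * h x $ 2"
    and base_change_forms: "linear_form (s * d) (- (s * b)) x = s * D * h x $ 1"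
      "linear_form (- (s * c)) (s * a) x = s * D * h x $ 2"
    and base_change_det: "x$1 * y$2 - x$2 * y$1 = D * (h x $ 1 * h y $ 2 - h x $ 2 * h y $ 1)"
proof -
  show D: "a * d - b * c = D" and "D * r = 1"
    using assms by (simp_all add: base_change_def)
  have h: "lin a b c d (h x) = x" for x
    using assms by (simp add: base_change_def)
  have x: "x $ 1 = a * h x $ 1 + b * h x $ 2" "x $ 2 = c * h x $ 1 + d * h x $ 2" for x
    using arg_cong[OF h[of x], of "\<lambda>v. v $ 1"] arg_cong[OF h[of x], of "\<lambda>v. v $ 2"] by simp_all
  show "x $ 1 = a * h x $ 1 + b * h x $ 2" "x $ 2 = c * h x $ 1 + d * h x $ 2" by (rule x)+
  show "linear_form (s * d) (- (s * b)) x = s * D * h x $ 1"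
    "linear_form (- (s * c)) (s * a) x = s * D * h x $ 2"
    unfolding linear_form_def x[of x] D[symmetric] by (simp_all add: algebra_simps)
  show "x$1 * y$2 - x$2 * y$1 = D * (h x $ 1 * h y $ 2 - h x $ 2 * h y $ 1)"
    unfolding x[of x] x[of y] D[symmetric] by (simp add: algebra_simps)
qed

lemma poly_over_coord: "(\<lambda>x. x i) \<in> G \<Longrightarrow> poly_over G (\<lambda>x. x i)"
  by (rule poly_over_gen)

lemmas poly_over_intros = poly_over_const poly_over_add poly_over_diff poly_over_minus
  poly_over_mult poly_over_coord

lemma poly_paramI:
  assumes "\<And>y z. poly_over G (\<lambda>x. fst (\<Phi> x) y z $ 1)" "\<And>y z. poly_over G (\<lambda>x. fst (\<Phi> x) y z $ 2)"
    and "\<And>y z. poly_over G (\<lambda>x. snd (\<Phi> x) y z $ 1)" "\<And>y z. poly_over G (\<lambda>x. snd (\<Phi> x) y z $ 2)"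
  shows "poly_param G \<Phi>"
proof -
  have "poly_over G (\<lambda>x. fst (\<Phi> x) y z $ k)" "poly_over G (\<lambda>x. snd (\<Phi> x) y z $ k)" for y z k
    using assms exhaust_2[of k] by (elim disjE; simp)+
  then show ?thesis unfolding poly_param_def by blast
qed

lemma orbit_dim_le_affine:
  assumes "A \<in> Bil2" "orbit A \<subseteq> range \<Phi>" "poly_param (set gs) \<Phi>"
  shows "orbit_dim A \<le> enat (length gs)"
  unfolding orbit_dim_def by (rule krull_dim_le_affine[OF orbit_Bil2 assms(2,3)]) (rule assms(1))

lemma orbit_dim_le_quadric:
  assumes "A \<in> Bil2" "orbit A \<subseteq> \<Phi> ` {x. x 0 * x 1 + x 2 * x 3 = 1}"
    and "poly_param (set ((\<lambda>x. x 0) # (\<lambda>x. x 1) # (\<lambda>x. x 2) # (\<lambda>x. x 3) # gs)) \<Phi>"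
  shows "orbit_dim A \<le> enat (3 + length gs)"
  unfolding orbit_dim_def
  by (rule krull_dim_le_quadric[OF orbit_Bil2 assms(2,3)]) (use assms(1) in auto)

lemma complex_cube_root: obtains z :: complex where "z ^ 3 = w"
proof (cases "w = 0")
  case True
  then show ?thesis using that[of 0] by simp
next
  case False
  have "exp (Ln w / 3) ^ 3 = w"
    using exp_divide_power_eq[of 3 "Ln w"] False by simp
  then show ?thesis by (rule that)
qed

text \<open>The transported operations are multiples of xi(y) xi(z) w, where w = (b, d) is the image
  of \<open>e2\<close> and xi annihilates w. The coefficients of xi are proportional to (d, -b), so
  a single pair of parameters describes both xi and w once their common scale is adjusted.\<close>

lemma orbit_dim_le_square:
  "orbit_dim (bil (k *s e2) 0 0 0, bil (l *s e2) 0 0 0) \<le> 2"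
proof -
  let ?A = "(bil (k *s e2) 0 0 0, bil (l *s e2) 0 0 0)"
  let ?P = "\<lambda>k x y z. (k * linear_form (x 0) (x 1) y * linear_form (x 0) (x 1) z) *s
    vector [- x 1, x 0] :: V"
  let ?F = "\<lambda>x :: nat \<Rightarrow> complex. (?P k x, ?P l x)"
  have "orbit ?A \<subseteq> range ?F"
  proof
    fix B assume "B \<in> orbit ?A"
    then obtain a b c d D r h where h: "base_change a b c d D r h"
      and B: "B = (\<lambda>x y. lin a b c d (fst (?A) (h x) (h y)), \<lambda>x y. lin a b c d (snd (?A) (h x) (h y)))"
      by (rule orbit_coordinates)
    \<comment> \<open>The scale \<open>z\<close> enters three times, twice through the form and once
      through the vector, while the two forms contribute the square of \<open>D\<close>. Hence the
      condition \<open>z ^ 3 * D\<^sup>2 = 1\<close>.\<close>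
    obtain z where z: "z ^ 3 = r\<^sup>2" by (rule complex_cube_root)
    have zD: "z ^ 3 * D\<^sup>2 = 1"
      unfolding z using base_change_r[OF h] by (simp add: power_mult_distrib[symmetric] mult.commute)
    let ?x = "\<lambda>i. [z * d, - (z * b)] ! i"
    have eq: "lin a b c d (bil (m *s e2) 0 0 0 (h x) (h y)) = ?P m ?x x y" for m x y
    proof -
      define u where "u = m * (h x $ 1 * h y $ 1)"
      have "?P m ?x x y = (m * (z * D * h x $ 1) * (z * D * h y $ 1)) *s vector [z * b, z * d]"
        by (simp add: base_change_forms[OF h])
      also have "\<dots> = ((z ^ 3 * D\<^sup>2) * u) *s vector [b, d]"
        by (simp add: vec2_eq_iff vector_2 u_def power2_eq_square power3_eq_cube mult_ac)
      also have "\<dots> = lin a b c d (bil (m *s e2) 0 0 0 (h x) (h y))"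
        unfolding zD by (simp add: vec2_eq_iff vector_2 u_def mult_ac)
      finally show ?thesis by (rule sym)
    qed
    show "B \<in> range ?F"
      unfolding B fst_conv snd_conv eq by (rule rangeI)
  qed
  moreover have "poly_param (set [\<lambda>x. x 0, \<lambda>x. x 1]) ?F"
    by (rule poly_paramI; simp only: fst_conv snd_conv vector_smult_component vector_2 linear_form_def)
      (intro poly_over_intros; simp)+
  ultimately have "orbit_dim ?A \<le> enat (length [\<lambda>x::nat \<Rightarrow> complex. x 0, \<lambda>x. x 1])"
    by (intro orbit_dim_le_affine) (auto simp: Bil2_def)
  then show ?thesis by (simp add: numeral_eq_enat numeral_eq_Suc)
qed

lemma orbit_dim_T1_le: "orbit_dim (alg T1) \<le> 2"
  using orbit_dim_le_square[of 0 1] by (simp add: vector_smult_lzero)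

lemma orbit_dim_T7_le: "orbit_dim (alg (T7 \<alpha>)) \<le> 2"
  using orbit_dim_le_square[of 1 \<alpha>] by simp

lemma orbit_dim_Zero_le: "orbit_dim (alg Zero) \<le> 0"
proof -
  have "orbit (alg Zero) \<subseteq> range (\<lambda>x :: unit. alg Zero)"
  proof
    fix B assume "B \<in> orbit (alg Zero)"
    then obtain a b c d D r h where h: "base_change a b c d D r h"
      and B: "B = (\<lambda>x y. lin a b c d (fst (alg Zero) (h x) (h y)), \<lambda>x y. lin a b c d (snd (alg Zero) (h x) (h y)))"
      by (rule orbit_coordinates)
    have "B = alg Zero"
      unfolding B by (simp add: fun_eq_iff vec2_eq_iff)
    then show "B \<in> range (\<lambda>x :: unit. alg Zero)" by blast
  qed
  moreover have "poly_param (set []) (\<lambda>x :: unit. alg Zero)"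
    by (rule poly_paramI; rule poly_over_const)
  ultimately have "orbit_dim (alg Zero) \<le> enat (length ([] :: (unit \<Rightarrow> complex) list))"
    by (intro orbit_dim_le_affine alg_Bil2)
  then show ?thesis by (simp add: zero_enat_def)
qed

lemma lin_e2: "lin a b c d (u *s e2) = u *s vector [b, d]"
  by (simp add: vec2_eq_iff vector_2 mult.commute)

lemma bracket_det: "bil 0 e2 (- e2) 0 x y = (x $ 1 * y $ 2 - x $ 2 * y $ 1) *s e2"
  by (simp add: vec2_eq_iff)

text \<open>The bracket of \<open>T2\<close> is the determinant of its arguments times
  \<open>e2\<close>, so a base change only replaces \<open>e2\<close> by its image divided by
  \<open>D\<close>.\<close>

lemma orbit_dim_T2_le: "orbit_dim (alg T2) \<le> 2"
proof -
  let ?F = "\<lambda>x :: nat \<Rightarrow> complex.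
    (\<lambda>y z. 0 :: V, \<lambda>y z. (y$1 * z$2 - y$2 * z$1) *s vector [x 0, x 1] :: V)"
  have "orbit (alg T2) \<subseteq> range ?F"
  proof
    fix B assume "B \<in> orbit (alg T2)"
    then obtain a b c d D r h where h: "base_change a b c d D r h"
      and B: "B = (\<lambda>x y. lin a b c d (fst (alg T2) (h x) (h y)), \<lambda>x y. lin a b c d (snd (alg T2) (h x) (h y)))"
      by (rule orbit_coordinates)
    let ?x = "\<lambda>i. [b * r, d * r] ! i"
    have "B = ?F ?x"
      unfolding B prod_eq_iff fun_eq_iff fst_conv snd_conv
    proof (intro conjI allI)
      fix x y
      show "lin a b c d (fst (alg T2) (h x) (h y)) = 0"
        by (simp add: vec2_eq_iff)
      have scale: "(D * u) *s vector [?x 0, ?x 1] = ((D * r) * u) *s (vector [b, d] :: V)" for u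
        by (simp add: vec2_eq_iff vector_2)
      have "(x$1 * y$2 - x$2 * y$1) *s vector [?x 0, ?x 1] =
          ((D * r) * (h x $ 1 * h y $ 2 - h x $ 2 * h y $ 1)) *s (vector [b, d] :: V)"
        unfolding base_change_det[OF h, of x y] by (rule scale)
      also have "\<dots> = lin a b c d (snd (alg T2) (h x) (h y))"
        by (simp only: base_change_r[OF h] alg.simps snd_conv bracket_det lin_e2 mult_1)
      finally show "lin a b c d (snd (alg T2) (h x) (h y)) =
          (x$1 * y$2 - x$2 * y$1) *s vector [?x 0, ?x 1]"
        by (rule sym)
    qed
    then show "B \<in> range ?F" by (rule range_eqI[of B ?F ?x])
  qed
  moreover have "poly_param (set [\<lambda>x. x 0, \<lambda>x. x 1]) ?F"
    by (rule poly_paramI; simp only: fst_conv snd_conv vector_smult_component vector_2 zero_index)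
      (intro poly_over_intros; simp)+
  ultimately have "orbit_dim (alg T2) \<le> enat (length [\<lambda>x::nat \<Rightarrow> complex. x 0, \<lambda>x. x 1])"
    by (intro orbit_dim_le_affine alg_Bil2)
  then show ?thesis by (simp add: numeral_eq_enat numeral_eq_Suc)
qed

text \<open>The bracket determines the vector (r b, r d) as for \<open>T2\<close>. This vector also
  gives the form (r d, -r b) dual to the image of \<open>e1\<close>; the product is then fixed up to
  the scalar \<open>D\<close>, the third parameter.\<close>

lemma orbit_dim_T8_le: "orbit_dim (alg T8) \<le> 3"
proof -
  let ?F = "\<lambda>x :: nat \<Rightarrow> complex.
    (\<lambda>y z. (x 2 * linear_form (x 1) (- x 0) y * linear_form (x 1) (- x 0) z) *s vector [x 0, x 1] :: V,
     \<lambda>y z. (y$1 * z$2 - y$2 * z$1) *s vector [x 0, x 1] :: V)"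
  have "orbit (alg T8) \<subseteq> range ?F"
  proof
    fix B assume "B \<in> orbit (alg T8)"
    then obtain a b c d D r h where h: "base_change a b c d D r h"
      and B: "B = (\<lambda>x y. lin a b c d (fst (alg T8) (h x) (h y)), \<lambda>x y. lin a b c d (snd (alg T8) (h x) (h y)))"
      by (rule orbit_coordinates)
    let ?x = "\<lambda>i. [r * b, r * d, D] ! i"
    have "B = ?F ?x"
      unfolding B prod_eq_iff fun_eq_iff fst_conv snd_conv
    proof (intro conjI allI)
      fix x y
      have "(?x 2 * linear_form (?x 1) (- ?x 0) x * linear_form (?x 1) (- ?x 0) y) *s vector [?x 0, ?x 1] =
          ((D * r) * (D * r) * (D * r) * (h x $ 1 * h y $ 1)) *s (vector [b, d] :: V)"
        by (simp add: base_change_forms[OF h] vec2_eq_iff vector_2)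
      also have "\<dots> = (h x $ 1 * h y $ 1) *s vector [b, d]"
        by (simp only: base_change_r[OF h] mult_1)
      also have "\<dots> = lin a b c d (fst (alg T8) (h x) (h y))"
        by (simp add: vec2_eq_iff vector_2)
      finally show "lin a b c d (fst (alg T8) (h x) (h y)) =
        (?x 2 * linear_form (?x 1) (- ?x 0) x * linear_form (?x 1) (- ?x 0) y) *s vector [?x 0, ?x 1]"
        by (rule sym)
      have scale: "(D * u) *s vector [?x 0, ?x 1] = ((D * r) * u) *s (vector [b, d] :: V)" for u
        by (simp add: vec2_eq_iff vector_2)
      have "(x$1 * y$2 - x$2 * y$1) *s vector [?x 0, ?x 1] =
          ((D * r) * (h x $ 1 * h y $ 2 - h x $ 2 * h y $ 1)) *s (vector [b, d] :: V)"
        unfolding base_change_det[OF h, of x y] by (rule scale)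
      also have "\<dots> = lin a b c d (snd (alg T8) (h x) (h y))"
        by (simp only: base_change_r[OF h] alg.simps snd_conv bracket_det lin_e2 mult_1)
      finally show "lin a b c d (snd (alg T8) (h x) (h y)) =
          (x$1 * y$2 - x$2 * y$1) *s vector [?x 0, ?x 1]"
        by (rule sym)
    qed
    then show "B \<in> range ?F" by (rule range_eqI[of B ?F ?x])
  qed
  moreover have "poly_param (set [\<lambda>x. x 0, \<lambda>x. x 1, \<lambda>x. x 2]) ?F"
    by (rule poly_paramI; simp only: fst_conv snd_conv vector_smult_component vector_2 linear_form_def)
      (intro poly_over_intros; simp)+
  ultimately have "orbit_dim (alg T8) \<le> enat (length [\<lambda>x::nat \<Rightarrow> complex. x 0, \<lambda>x. x 1, \<lambda>x. x 2])"
    by (intro orbit_dim_le_affine alg_Bil2)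
  then show ?thesis by (simp add: numeral_eq_enat numeral_eq_Suc)
qed

text \<open>For \<open>T3\<close>, ..., \<open>T6\<close> the parameters \<open>x 0, x 2\<close> are the coefficients of the linear form dual
  to the image of \<open>e1\<close>, and \<open>x 1, x 3\<close> are the coordinates of that image.\<close>

lemma orbit_dim_le_quadric_alg:
  assumes "\<And>a b c d D r h. base_change a b c d D r h \<Longrightarrow>
      (\<lambda>x y. lin a b c d (fst A (h x) (h y)), \<lambda>x y. lin a b c d (snd A (h x) (h y))) =
      \<Phi> (\<lambda>i. [r * d, a, - (r * b), c, \<tau> D r] ! i)"
    and "A \<in> Bil2" "poly_param (set ((\<lambda>x. x 0) # (\<lambda>x. x 1) # (\<lambda>x. x 2) # (\<lambda>x. x 3) # gs)) \<Phi>"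
  shows "orbit_dim A \<le> enat (3 + length gs)"
proof (rule orbit_dim_le_quadric[OF assms(2) _ assms(3)])
  show "orbit A \<subseteq> \<Phi> ` {x. x 0 * x 1 + x 2 * x 3 = 1}"
  proof
    fix B assume "B \<in> orbit A"
    then obtain a b c d D r h where h: "base_change a b c d D r h"
      and B: "B = (\<lambda>x y. lin a b c d (fst A (h x) (h y)), \<lambda>x y. lin a b c d (snd A (h x) (h y)))"
      by (rule orbit_coordinates)
    have t: "B = \<Phi> (\<lambda>i. [r * d, a, - (r * b), c, \<tau> D r] ! i)"
      unfolding B by (rule assms(1)[OF h])
    \<comment> \<open>The left side is the dual form evaluated at the image of
      \<open>e1\<close>.\<close>
    have "r * d * a + - (r * b) * c = (a * d - b * c) * r"
      by (simp add: algebra_simps)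
    also have "\<dots> = 1"
      unfolding base_change_D[OF h] by (rule base_change_r[OF h])
    finally show "B \<in> \<Phi> ` {x. x 0 * x 1 + x 2 * x 3 = 1}"
      unfolding t by (intro imageI) (simp add: numeral_eq_Suc)
  qed
qed

definition idempotent_product :: "(nat \<Rightarrow> complex) \<Rightarrow> V \<Rightarrow> V \<Rightarrow> V" where
  "idempotent_product x y z =
     (linear_form (x 0) (x 2) y * linear_form (x 0) (x 2) z) *s vector [x 1, x 3]"

text \<open>With xi(v) = 1 this is the product with unit v for which the kernel of xi squares to
  zero. No vector of the kernel is singled out, so rescaling the second basis vector adds no
  parameter.\<close>

definition unital_product :: "(nat \<Rightarrow> complex) \<Rightarrow> V \<Rightarrow> V \<Rightarrow> V" where
  "unital_product x y z =
     linear_form (x 0) (x 2) y *s z + linear_form (x 0) (x 2) z *s y - idempotent_product x y z"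

lemma base_change_form:
  "base_change a b c d D r h \<Longrightarrow> linear_form (r * d) (- (r * b)) x = h x $ 1"
  using base_change_forms(1)[of a b c d D r h r x] base_change_r[of a b c d D r h]
  by (simp add: mult.commute)

lemma idempotent_product_eq:
  assumes "base_change a b c d D r h"
  shows "idempotent_product (\<lambda>i. [r * d, a, - (r * b), c, t] ! i) x y =
    lin a b c d (bil e1 0 0 0 (h x) (h y))"
  unfolding idempotent_product_def
  by (simp add: numeral_eq_Suc base_change_form[OF assms] del: One_nat_def)
    (simp add: vec2_eq_iff vector_2 mult_ac)

lemma unital_product_eq:
  assumes "base_change a b c d D r h"
  shows "unital_product (\<lambda>i. [r * d, a, - (r * b), c, t] ! i) x y =
    lin a b c d (bil e1 e2 e2 0 (h x) (h y))"
proof -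
  have "unital_product (\<lambda>i. [r * d, a, - (r * b), c, t] ! i) x y =
      h x $ 1 *s y + h y $ 1 *s x - lin a b c d (bil e1 0 0 0 (h x) (h y))"
    unfolding unital_product_def idempotent_product_eq[OF assms]
    by (simp add: numeral_eq_Suc base_change_form[OF assms])
  also have "\<dots> = lin a b c d (bil e1 e2 e2 0 (h x) (h y))"
    unfolding vec2_eq_iff vector_minus_component vector_add_component vector_smult_component
      base_change_x[OF assms, of x] base_change_x[OF assms, of y]
    by (simp add: algebra_simps)
  finally show ?thesis .
qed

lemma base_change_lin: "base_change a b c d D r h \<Longrightarrow> lin a b c d (h x) = x"
  by (simp add: base_change_def)

text \<open>The vector (r b, r d) is formed from the coefficients of xi and spans its kernel;
  multiplied by \<open>D\<close> it becomes the image of \<open>e2\<close>.\<close>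

lemma base_change_scale:
  assumes "base_change a b c d D r h"
  shows "(u * D) *s vector [r * b, r * d] = u *s (vector [b, d] :: V)"
proof -
  have "u * D * (r * v) = (D * r) * (u * v)" for v by (simp only: mult_ac)
  then show ?thesis
    unfolding base_change_r[OF assms] by (simp add: vec2_eq_iff vector_2)
qed

lemma orbit_dim_T6_le: "orbit_dim (alg T6) \<le> 3"
proof -
  let ?F = "\<lambda>x. (idempotent_product x, \<lambda>y z. 0)"
  have param: "poly_param (set ((\<lambda>x. x 0) # (\<lambda>x. x 1) # (\<lambda>x. x 2) # (\<lambda>x. x 3) # [])) ?F"
    by (rule poly_paramI; simp only: fst_conv snd_conv idempotent_product_def vector_smult_component vector_2 linear_form_def)
      (intro poly_over_intros; simp)+
  have "orbit_dim (alg T6) \<le> enat (3 + length ([] :: ((nat \<Rightarrow> complex) \<Rightarrow> complex) list))"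
  proof (rule orbit_dim_le_quadric_alg[where \<tau> = "\<lambda>D r. 0", OF _ alg_Bil2 param])
    fix a b c d D r h assume h: "base_change a b c d D r h"
    show "(\<lambda>x y. lin a b c d (fst (alg T6) (h x) (h y)),
        \<lambda>x y. lin a b c d (snd (alg T6) (h x) (h y))) =
      (idempotent_product (\<lambda>i. [r * d, a, - (r * b), c, 0] ! i), \<lambda>y z. 0)"
      unfolding prod_eq_iff fun_eq_iff fst_conv snd_conv idempotent_product_eq[OF h]
      by (simp add: vec2_eq_iff)
  qed
  then show ?thesis by (simp add: numeral_eq_enat)
qed

text \<open>The bracket of \<open>T5\<close> is \<open>\<beta>\<close> times xi(y) z - xi(z) y,
  which, like the product, involves only xi and v.\<close>

lemma orbit_dim_T5_le: "orbit_dim (alg (T5 \<beta>)) \<le> 3"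
proof -
  let ?F = "\<lambda>x. (unital_product x,
    \<lambda>y z. \<beta> *s (linear_form (x 0) (x 2) y *s z - linear_form (x 0) (x 2) z *s y))"
  have param: "poly_param (set ((\<lambda>x. x 0) # (\<lambda>x. x 1) # (\<lambda>x. x 2) # (\<lambda>x. x 3) # [])) ?F"
    by (rule poly_paramI; simp only: fst_conv snd_conv unital_product_def idempotent_product_def vector_smult_component vector_add_component vector_minus_component vector_2 linear_form_def)
      (intro poly_over_intros; simp)+
  have "orbit_dim (alg (T5 \<beta>)) \<le> enat (3 + length ([] :: ((nat \<Rightarrow> complex) \<Rightarrow> complex) list))"
  proof (rule orbit_dim_le_quadric_alg[where \<tau> = "\<lambda>D r. 0", OF _ alg_Bil2 param])
    fix a b c d D r h assume h: "base_change a b c d D r h"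
    have bracket: "lin a b c d (bil 0 (\<beta> *s e2) (- (\<beta> *s e2)) 0 (h x) (h y)) =
        (\<beta> * h x $ 1) *s y - (\<beta> * h y $ 1) *s x" for x y
    proof -
      have "lin a b c d (bil 0 (\<beta> *s e2) (- (\<beta> *s e2)) 0 u w) =
          (\<beta> * u $ 1) *s lin a b c d w - (\<beta> * w $ 1) *s lin a b c d u" for u w
        unfolding vec2_eq_iff vector_minus_component vector_smult_component lin_nth bil_nth
          vector_uminus_component e2_nth zero_index
        by (intro conjI; algebra)
      from this[of "h x" "h y"] show ?thesis
        by (simp only: base_change_lin[OF h])
    qed
    show "(\<lambda>x y. lin a b c d (fst (alg (T5 \<beta>)) (h x) (h y)),
        \<lambda>x y. lin a b c d (snd (alg (T5 \<beta>)) (h x) (h y))) = ?F (\<lambda>i. [r * d, a, - (r * b), c, 0] ! i)"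
      unfolding prod_eq_iff fun_eq_iff fst_conv snd_conv unital_product_eq[OF h]
      by (simp add: numeral_eq_Suc base_change_form[OF h] bracket)
  qed
  then show ?thesis by (simp add: numeral_eq_enat)
qed

text \<open>Here the bracket takes values in multiples of the image of \<open>e2\<close> itself, not
  just in the line it spans; the fifth parameter \<open>D\<close> recovers its scale.\<close>

lemma orbit_dim_T4_le: "orbit_dim (alg T4) \<le> 4"
proof -
  let ?F = "\<lambda>x. (unital_product x,
    \<lambda>y z. (linear_form (x 0) (x 2) y * linear_form (x 0) (x 2) z * x 4) *s vector [- x 2, x 0] :: V)"
  have param: "poly_param (set ((\<lambda>x. x 0) # (\<lambda>x. x 1) # (\<lambda>x. x 2) # (\<lambda>x. x 3) # (\<lambda>x. x 4) # [])) ?F"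
    by (rule poly_paramI; simp only: fst_conv snd_conv unital_product_def idempotent_product_def vector_smult_component vector_add_component vector_minus_component vector_2 linear_form_def)
      (intro poly_over_intros; simp)+
  have "orbit_dim (alg T4) \<le> enat (3 + length ((\<lambda>x :: nat \<Rightarrow> complex. x 4) # []))"
  proof (rule orbit_dim_le_quadric_alg[where \<tau> = "\<lambda>D r. D", OF _ alg_Bil2 param])
    fix a b c d D r h assume h: "base_change a b c d D r h"
    have bracket: "(h x $ 1 * h y $ 1 * D) *s vector [r * b, r * d] =
        lin a b c d (bil e2 0 0 0 (h x) (h y))" for x y
    proof -
      have "bil e2 0 0 0 (h x) (h y) = (h x $ 1 * h y $ 1) *s e2"
        by (simp add: vec2_eq_iff)
      then show ?thesis by (simp only: base_change_scale[OF h] lin_e2)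
    qed
    show "(\<lambda>x y. lin a b c d (fst (alg T4) (h x) (h y)),
        \<lambda>x y. lin a b c d (snd (alg T4) (h x) (h y))) = ?F (\<lambda>i. [r * d, a, - (r * b), c, D] ! i)"
      unfolding prod_eq_iff fun_eq_iff fst_conv snd_conv unital_product_eq[OF h]
      by (simp add: numeral_eq_Suc base_change_form[OF h] bracket)
  qed
  then show ?thesis by (simp add: numeral_eq_enat)
qed

text \<open>The second idempotent contributes the form (-c, a), which is \<open>D\<close> times a
  dual form and occurs twice, and the vector (r b, r d). The weight \<open>r\<close> balances these
  factors: \<open>r * D * D * r = 1\<close>.\<close>

lemma orbit_dim_T3_le: "orbit_dim (alg T3) \<le> 4"
proof -
  let ?F = "\<lambda>x. (\<lambda>y z. idempotent_product x y z +
      (x 4 * linear_form (- x 3) (x 1) y * linear_form (- x 3) (x 1) z) *s vector [- x 2, x 0],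
    \<lambda>y z. 0 :: V)"
  have param: "poly_param (set ((\<lambda>x. x 0) # (\<lambda>x. x 1) # (\<lambda>x. x 2) # (\<lambda>x. x 3) # (\<lambda>x. x 4) # [])) ?F"
    by (rule poly_paramI; simp only: fst_conv snd_conv idempotent_product_def vector_smult_component vector_add_component vector_minus_component vector_2 linear_form_def zero_index)
      (intro poly_over_intros; simp)+
  have "orbit_dim (alg T3) \<le> enat (3 + length ((\<lambda>x :: nat \<Rightarrow> complex. x 4) # []))"
  proof (rule orbit_dim_le_quadric_alg[where \<tau> = "\<lambda>D r. r", OF _ alg_Bil2 param])
    fix a b c d D r h assume h: "base_change a b c d D r h"
    have form: "linear_form (- c) a x = D * h x $ 2" for x
      using base_change_forms(2)[OF h, of 1] by simp
    have product: "lin a b c d (bil e1 0 0 0 (h x) (h y)) +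
        (r * (D * h x $ 2) * (D * h y $ 2)) *s vector [r * b, r * d] =
        lin a b c d (bil e1 0 0 e2 (h x) (h y))" for x y
    proof -
      have "r * (D * h x $ 2) * (D * h y $ 2) = (D * r) * (h x $ 2 * h y $ 2) * D"
        by (simp only: mult_ac)
      then have 1: "r * (D * h x $ 2) * (D * h y $ 2) = h x $ 2 * h y $ 2 * D"
        by (simp only: base_change_r[OF h] mult_1)
      show ?thesis
        unfolding 1 base_change_scale[OF h] by (simp add: vec2_eq_iff vector_2 mult.commute)
    qed
    show "(\<lambda>x y. lin a b c d (fst (alg T3) (h x) (h y)),
        \<lambda>x y. lin a b c d (snd (alg T3) (h x) (h y))) = ?F (\<lambda>i. [r * d, a, - (r * b), c, r] ! i)"
      unfolding prod_eq_iff fun_eq_iff fst_conv snd_conv idempotent_product_eq[OF h]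
    proof (intro conjI allI)
      show "lin a b c d (snd (alg T3) (h x) (h y)) = 0" for x y
        by (simp add: vec2_eq_iff)
    qed (simp add: numeral_eq_Suc form product)
  qed
  then show ?thesis by (simp add: numeral_eq_enat)
qed

section \<open>Lower bounds from chains of irreducible sets\<close>

inductive irreducible_chain :: "nat \<Rightarrow> bracket_pair set \<Rightarrow> bool" where
  start: "irreducible_set W \<Longrightarrow> irreducible_chain 0 W"
| step: "irreducible_chain n W' \<Longrightarrow> W' \<subseteq> W \<Longrightarrow> irreducible_set W \<Longrightarrow> polynomial_fun q \<Longrightarrow>
    (\<And>B. B \<in> W' \<Longrightarrow> q B = 0) \<Longrightarrow> C \<in> W \<Longrightarrow> q C \<noteq> 0 \<Longrightarrow> irreducible_chain (Suc n) W"

text \<open>A set and its closure satisfy the same polynomial equations. Hence chains may be built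
  from sets that are not closed and be closed up in the orbit afterwards.\<close>

lemma irreducible_set_closure:
  assumes "irreducible_set W" "W \<subseteq> X" "X \<subseteq> Bil2"
  shows "irreducible_set (X \<inter> zariski closure_of W)"
proof -
  have WB: "W \<subseteq> Bil2" using assms by blast
  note closure = closure_of_zariski[OF WB]
  have sub: "W \<subseteq> X \<inter> zariski closure_of W"
    using assms(2) WB closure_of_subset[of W zariski] by (simp add: topspace_zariski)
  show ?thesis
    unfolding irreducible_set_def
  proof (intro conjI allI impI)
    show "X \<inter> zariski closure_of W \<noteq> {}"
      using assms(1) sub unfolding irreducible_set_def by blast
    fix p q assume pq: "polynomial_fun p \<and> polynomial_fun q \<and>
      (\<forall>A\<in>X \<inter> zariski closure_of W. p A * q A = 0)"
    then have "\<forall>A\<in>W. p A * q A = 0" using sub by blast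
    then have "(\<forall>A\<in>W. p A = 0) \<or> (\<forall>A\<in>W. q A = 0)"
      using assms(1) pq unfolding irreducible_set_def by blast
    then show "(\<forall>A\<in>X \<inter> zariski closure_of W. p A = 0) \<or> (\<forall>A\<in>X \<inter> zariski closure_of W. q A = 0)"
      using pq closure by blast
  qed
qed

lemma irreducible_chain_closures:
  assumes "irreducible_chain n W" "W \<subseteq> X" "X \<subseteq> Bil2"
  shows "\<exists>Z. Z n = X \<inter> zariski closure_of W \<and> (\<forall>i<n. Z i \<subset> Z (Suc i)) \<and>
    (\<forall>i\<le>n. closedin (subtopology zariski X) (Z i) \<and>
       irreducible_space (subtopology (subtopology zariski X) (Z i)))"
  using assms
proof (induction rule: irreducible_chain.induct)
  have ok: "closedin (subtopology zariski X) (X \<inter> zariski closure_of W) \<and>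
      irreducible_space (subtopology (subtopology zariski X) (X \<inter> zariski closure_of W))"
    if "irreducible_set W" "W \<subseteq> X" for W
  proof
    show "closedin (subtopology zariski X) (X \<inter> zariski closure_of W)"
      unfolding closedin_subtopology using closedin_closure_of by blast
    have "irreducible_space (subtopology zariski (X \<inter> zariski closure_of W))"
      using irreducible_set_closure[OF that assms(3)] assms(3) irreducible_space_iff by blast
    then show "irreducible_space (subtopology (subtopology zariski X) (X \<inter> zariski closure_of W))"
      by (simp add: subtopology_subtopology)
  qed
  {
    case (start W)
    then show ?case
      using ok[of W] by (intro exI[of _ "\<lambda>_. X \<inter> zariski closure_of W"]) simp
  next
    case (step n W' W q C)
    then have sub: "W' \<subseteq> X" "W \<subseteq> X" by auto
    obtain Z where Z: "Z n = X \<inter> zariski closure_of W'" "\<forall>i<n. Z i \<subset> Z (Suc i)"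
      "\<forall>i\<le>n. closedin (subtopology zariski X) (Z i) \<and>
         irreducible_space (subtopology (subtopology zariski X) (Z i))"
      using step.IH[OF sub(1) \<open>X \<subseteq> Bil2\<close>] by blast
    have WB: "W' \<subseteq> Bil2" "W \<subseteq> Bil2" using sub \<open>X \<subseteq> Bil2\<close> by auto
    \<comment> \<open>The polynomial \<open>q\<close> vanishes on \<open>W'\<close>, hence on its
      closure, but not at \<open>C\<close>; so the inclusion stays strict after taking
      closures.\<close>
    have "C \<notin> zariski closure_of W'"
      using closure_of_zariski[OF WB(1)] step.hyps by blast
    moreover have "C \<in> zariski closure_of W"
      using closure_of_subset[of W zariski] WB(2) \<open>C \<in> W\<close> by (auto simp: topspace_zariski)
    moreover have "zariski closure_of W' \<subseteq> zariski closure_of W"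
      using closure_of_mono[OF \<open>W' \<subseteq> W\<close>] .
    ultimately have strict: "X \<inter> zariski closure_of W' \<subset> X \<inter> zariski closure_of W"
      using sub(2) \<open>C \<in> W\<close> by blast
    define Z' where "Z' i = (if i = Suc n then X \<inter> zariski closure_of W else Z i)" for i
    have "\<forall>i<Suc n. Z' i \<subset> Z' (Suc i)"
      using Z(1,2) strict by (auto simp: Z'_def less_Suc_eq)
    moreover have "\<forall>i\<le>Suc n. closedin (subtopology zariski X) (Z' i) \<and>
         irreducible_space (subtopology (subtopology zariski X) (Z' i))"
      using Z(3) ok[OF \<open>irreducible_set W\<close> sub(2)] by (auto simp: Z'_def le_Suc_eq)
    ultimately show ?case
      by (intro exI[of _ Z']) (simp add: Z'_def)
  }
qed

lemma krull_dim_ge: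
  assumes "irreducible_chain n W" "W \<subseteq> X" "X \<subseteq> Bil2"
  shows "enat n \<le> krull_dim (subtopology zariski X)"
  unfolding krull_dim_def
  by (rule Sup_upper) (use irreducible_chain_closures[OF assms] in blast)

section \<open>Parts of an orbit given by affine families of matrices\<close>

type_synonym quadruple = "complex \<times> complex \<times> complex \<times> complex"

definition partial_orbit :: "bracket_pair \<Rightarrow> quadruple set \<Rightarrow> bracket_pair set" where
  "partial_orbit A S = {act (lin a b c d) A |a b c d. (a, b, c, d) \<in> S \<and> a * d - b * c \<noteq> 0}"

definition line_closed :: "quadruple set \<Rightarrow> bool" where
  "line_closed S \<longleftrightarrow> (\<forall>a b c d a' b' c' d' s. (a, b, c, d) \<in> S \<longrightarrow> (a', b', c', d') \<in> S \<longrightarrow>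
     (a + s * (a' - a), b + s * (b' - b), c + s * (c' - c), d + s * (d' - d)) \<in> S)"

lemma partial_orbit_subset: "partial_orbit A S \<subseteq> orbit A"
  unfolding partial_orbit_def orbit_def using lin_GL by blast

text \<open>The inverse matrix is the adjugate divided by \<open>D\<close>, and bilinearity moves
  both factors \<open>1 / D\<close> to the front. What remains is polynomial in the matrix
  entries.\<close>

lemma act_lin:
  assumes "A \<in> Bil2" "a * d - b * c = D" "D \<noteq> 0"
  shows "fst (act (lin a b c d) A) x y =
      (1 / D\<^sup>2) *s lin a b c d (fst A (lin d (- b) (- c) a x) (lin d (- b) (- c) a y))"
    and "snd (act (lin a b c d) A) x y =
      (1 / D\<^sup>2) *s lin a b c d (snd A (lin d (- b) (- c) a x) (lin d (- b) (- c) a y))"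
proof -
  have inv: "inv (lin a b c d) x = (1 / D) *s lin d (- b) (- c) a x" for x
    unfolding inv_lin[OF assms(2,3)] vec2_eq_iff by (simp add: add_divide_distrib diff_divide_distrib)
  have lin: "lin a b c d (k *s x) = k *s lin a b c d x" for k x
    by (simp add: vec2_eq_iff distrib_left mult.left_commute)
  have "complex_bilinear (fst A)" "complex_bilinear (snd A)"
    using assms(1) by (auto simp: Bil2_def)
  then show "fst (act (lin a b c d) A) x y =
      (1 / D\<^sup>2) *s lin a b c d (fst A (lin d (- b) (- c) a x) (lin d (- b) (- c) a y))"
    "snd (act (lin a b c d) A) x y =
      (1 / D\<^sup>2) *s lin a b c d (snd A (lin d (- b) (- c) a x) (lin d (- b) (- c) a y))"
    by (simp_all add: act_def case_prod_unfold inv lin complex_bilinear_iff power2_eq_square)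
qed

lemma poly_deg_id_poly:
  "poly_deg {\<lambda>s. s} n f \<Longrightarrow> \<exists>P :: complex poly. \<forall>s. f s = poly P s"
proof (induction rule: poly_deg.induct)
  case (const c)
  then show ?case by (intro exI[of _ "[:c:]"]) simp
next
  case (gen g)
  then show ?case by (intro exI[of _ "[:0, 1:]"]) simp
next
  case (add n f g)
  then obtain P Q where "\<forall>s. f s = poly P s" "\<forall>s. g s = poly Q s" by blast
  then show ?case by (intro exI[of _ "P + Q"]) simp
next
  case (mult m f n g)
  then obtain P Q where "\<forall>s. f s = poly P s" "\<forall>s. g s = poly Q s" by blast
  then show ?case by (intro exI[of _ "P * Q"]) simp
qed

lemma poly_over_id_common_nonzero:
  fixes f g h :: "complex \<Rightarrow> complex"
  assumes "poly_over {\<lambda>s. s} f" "poly_over {\<lambda>s. s} g" "poly_over {\<lambda>s. s} h"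
    and "f u \<noteq> 0" "g v \<noteq> 0" "h w \<noteq> 0"
  obtains s where "f s \<noteq> 0" "g s \<noteq> 0" "h s \<noteq> 0"
proof -
  obtain P Q R where P: "\<forall>s. f s = poly P s" and Q: "\<forall>s. g s = poly Q s" and R: "\<forall>s. h s = poly R s"
    using assms(1-3) poly_deg_id_poly unfolding poly_over_def by metis
  have "P \<noteq> 0" "Q \<noteq> 0" "R \<noteq> 0"
    using P Q R assms(4-6) by auto
  then have "finite {s. poly (P * Q * R) s = 0}"
    by (intro poly_roots_finite) simp
  then obtain s where "poly (P * Q * R) s \<noteq> 0"
    using infinite_UNIV_char_0[where 'a = complex] by (metis (mono_tags) UNIV_eq_I mem_Collect_eq)
  then show ?thesis
    using that[of s] P Q R by simp
qed

text \<open>Each structure constant of the transformed algebra is a polynomial in \<open>s\<close>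
  divided by the square of the determinant, so a power of the determinant clears the denominators of
  \<open>p\<close>.\<close>

lemma polynomial_fun_on_line:
  fixes a b c d :: "complex \<Rightarrow> complex"
  assumes "polynomial_fun p" "A \<in> Bil2"
    and "poly_over {\<lambda>s. s} a" "poly_over {\<lambda>s. s} b" "poly_over {\<lambda>s. s} c" "poly_over {\<lambda>s. s} d"
  shows "\<exists>e F. poly_over {\<lambda>s. s} F \<and> (\<forall>s. a s * d s - b s * c s \<noteq> 0 \<longrightarrow>
    p (act (lin (a s) (b s) (c s) (d s)) A) * (a s * d s - b s * c s) ^ e = F s)"
  using assms(1)
proof (induction rule: polynomial_fun.induct)
  case (const k)
  show ?case by (intro exI[of _ 0] exI[of _ "\<lambda>_. k"]) (auto intro: poly_over_const)
next
  case (coord_fst i j k)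
  define F where "F s = lin (a s) (b s) (c s) (d s)
    (fst A (lin (d s) (- b s) (- c s) (a s) (axis i 1)) (lin (d s) (- b s) (- c s) (a s) (axis j 1))) $ k"
    for s
  have A: "complex_bilinear (fst A)" using assms(2) by (auto simp: Bil2_def)
  have "poly_over {\<lambda>s. s} F"
    using exhaust_2[of k] unfolding F_def
    by (elim disjE; subst complex_bilinear_eq_bil[OF A]; simp only: lin_nth bil_nth)
      (intro poly_over_add poly_over_mult poly_over_minus poly_over_const assms)+
  moreover have "fst (act (lin (a s) (b s) (c s) (d s)) A) (axis i 1) (axis j 1) $ k *
      (a s * d s - b s * c s)\<^sup>2 = F s" if "a s * d s - b s * c s \<noteq> 0" for s
    unfolding act_lin[OF assms(2) refl that] F_def using that by simp
  ultimately show ?case by blast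
next
  case (coord_snd i j k)
  define F where "F s = lin (a s) (b s) (c s) (d s)
    (snd A (lin (d s) (- b s) (- c s) (a s) (axis i 1)) (lin (d s) (- b s) (- c s) (a s) (axis j 1))) $ k"
    for s
  have A: "complex_bilinear (snd A)" using assms(2) by (auto simp: Bil2_def)
  have "poly_over {\<lambda>s. s} F"
    using exhaust_2[of k] unfolding F_def
    by (elim disjE; subst complex_bilinear_eq_bil[OF A]; simp only: lin_nth bil_nth)
      (intro poly_over_add poly_over_mult poly_over_minus poly_over_const assms)+
  moreover have "snd (act (lin (a s) (b s) (c s) (d s)) A) (axis i 1) (axis j 1) $ k *
      (a s * d s - b s * c s)\<^sup>2 = F s" if "a s * d s - b s * c s \<noteq> 0" for s
    unfolding act_lin[OF assms(2) refl that] F_def using that by simp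
  ultimately show ?case by blast
next
  case (add p q)
  let ?D = "\<lambda>s. a s * d s - b s * c s"
  have D: "poly_over {\<lambda>s. s} (\<lambda>s. ?D s ^ n)" for n
    by (intro poly_over_power poly_over_diff poly_over_mult assms)
  obtain e F e' F' where "poly_over {\<lambda>s. s} F" "poly_over {\<lambda>s. s} F'"
    "\<And>s. ?D s \<noteq> 0 \<Longrightarrow> p (act (lin (a s) (b s) (c s) (d s)) A) * ?D s ^ e = F s"
    "\<And>s. ?D s \<noteq> 0 \<Longrightarrow> q (act (lin (a s) (b s) (c s) (d s)) A) * ?D s ^ e' = F' s"
    using add.IH by metis
  note F = this
  \<comment> \<open>The two summands may need different powers; \<open>e + e'\<close> is a common
    one.\<close>
  have "(p (act (lin (a s) (b s) (c s) (d s)) A) + q (act (lin (a s) (b s) (c s) (d s)) A)) *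
      ?D s ^ (e + e') = F s * ?D s ^ e' + F' s * ?D s ^ e" if "?D s \<noteq> 0" for s
    unfolding F(3,4)[OF that, symmetric] power_add distrib_right by (simp only: mult_ac)
  then show ?case
    using poly_over_add[OF poly_over_mult[OF F(1) D[of e']] poly_over_mult[OF F(2) D[of e]]] by blast
next
  case (mult p q)
  let ?D = "\<lambda>s. a s * d s - b s * c s"
  obtain e F e' F' where "poly_over {\<lambda>s. s} F" "poly_over {\<lambda>s. s} F'"
    "\<And>s. ?D s \<noteq> 0 \<Longrightarrow> p (act (lin (a s) (b s) (c s) (d s)) A) * ?D s ^ e = F s"
    "\<And>s. ?D s \<noteq> 0 \<Longrightarrow> q (act (lin (a s) (b s) (c s) (d s)) A) * ?D s ^ e' = F' s"
    using mult.IH by metis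
  note F = this
  have "p (act (lin (a s) (b s) (c s) (d s)) A) * q (act (lin (a s) (b s) (c s) (d s)) A) *
      ?D s ^ (e + e') = F s * F' s" if "?D s \<noteq> 0" for s
    unfolding F(3,4)[OF that, symmetric] power_add by (simp only: mult_ac)
  then show ?case
    using poly_over_mult[OF F(1,2)] by blast
qed

text \<open>Two polynomials that do not vanish at given points of a set of matrices closed under lines
  do not vanish simultaneously at some invertible point of the line through them.\<close>

lemma irreducible_partial_orbit:
  assumes A: "A \<in> Bil2" and S: "line_closed S" and ne: "partial_orbit A S \<noteq> {}"
  shows "irreducible_set (partial_orbit A S)"
  unfolding irreducible_set_def
proof (intro conjI ne allI impI)
  fix p q assume pq: "polynomial_fun p \<and> polynomial_fun q \<and> (\<forall>B\<in>partial_orbit A S. p B * q B = 0)"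
  show "(\<forall>B\<in>partial_orbit A S. p B = 0) \<or> (\<forall>B\<in>partial_orbit A S. q B = 0)"
  proof (rule ccontr)
    assume "\<not> ?thesis"
    then obtain a b c d a' b' c' d' where
      abcd: "(a, b, c, d) \<in> S" "a * d - b * c \<noteq> 0" "p (act (lin a b c d) A) \<noteq> 0" and
      abcd': "(a', b', c', d') \<in> S" "a' * d' - b' * c' \<noteq> 0" "q (act (lin a' b' c' d') A) \<noteq> 0"
      unfolding partial_orbit_def by blast
    define u v w z where uvwz: "u = (\<lambda>s. a + s * (a' - a))" "v = (\<lambda>s. b + s * (b' - b))"
      "w = (\<lambda>s. c + s * (c' - c))" "z = (\<lambda>s. d + s * (d' - d))"
    let ?D = "\<lambda>s. u s * z s - v s * w s"
    have line: "poly_over {\<lambda>s. s} u" "poly_over {\<lambda>s. s} v" "poly_over {\<lambda>s. s} w" "poly_over {\<lambda>s. s} z"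
      unfolding uvwz by (intro poly_over_add poly_over_mult poly_over_const poly_over_gen singletonI)+
    obtain e F where F: "poly_over {\<lambda>s. s} F"
      "\<And>s. ?D s \<noteq> 0 \<Longrightarrow> p (act (lin (u s) (v s) (w s) (z s)) A) * ?D s ^ e = F s"
      using polynomial_fun_on_line[of p, OF _ A line] pq by blast
    obtain e' F' where F': "poly_over {\<lambda>s. s} F'"
      "\<And>s. ?D s \<noteq> 0 \<Longrightarrow> q (act (lin (u s) (v s) (w s) (z s)) A) * ?D s ^ e' = F' s"
      using polynomial_fun_on_line[of q, OF _ A line] pq by blast
    have D: "poly_over {\<lambda>s. s} ?D"
      by (intro poly_over_diff poly_over_mult line)
    have at0: "u 0 = a" "v 0 = b" "w 0 = c" "z 0 = d" and at1: "u 1 = a'" "v 1 = b'" "w 1 = c'" "z 1 = d'"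
      by (simp_all add: uvwz)
    have "F 0 \<noteq> 0"
      using F(2)[of 0] abcd(2,3) unfolding at0 by (metis mult_eq_0_iff power_eq_0_iff)
    moreover have "F' 1 \<noteq> 0"
      using F'(2)[of 1] abcd'(2,3) unfolding at1 by (metis mult_eq_0_iff power_eq_0_iff)
    \<comment> \<open>The determinant is the third polynomial, so that the common point found on the
      line is an invertible matrix.\<close>
    moreover have "?D 0 \<noteq> 0"
      unfolding at0 by (rule abcd(2))
    ultimately obtain s where s: "F s \<noteq> 0" "F' s \<noteq> 0" "?D s \<noteq> 0"
      using poly_over_id_common_nonzero[OF F(1) F'(1) D] by blast
    have "(u s, v s, w s, z s) \<in> S"
      using S abcd(1) abcd'(1) unfolding line_closed_def uvwz by blast
    then have "act (lin (u s) (v s) (w s) (z s)) A \<in> partial_orbit A S"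
      using s(3) unfolding partial_orbit_def by blast
    then have "p (act (lin (u s) (v s) (w s) (z s)) A) * q (act (lin (u s) (v s) (w s) (z s)) A) = 0"
      using pq by blast
    then show False
      using F(2)[OF s(3)] F'(2)[OF s(3)] s(1,2) by (metis mult_eq_0_iff)
  qed
qed

lemma irreducible_chain_start:
  assumes "A \<in> Bil2"
  shows "irreducible_chain 0 (partial_orbit A {(a, b, c, d). a = 1 \<and> b = 0 \<and> c = 0 \<and> d = 1})"
proof (rule irreducible_chain.start, rule irreducible_partial_orbit[OF assms])
  show "line_closed {(a, b, c, d). a = 1 \<and> b = 0 \<and> c = 0 \<and> d = 1}"
    by (simp add: line_closed_def)
  have "act (lin 1 0 0 1) A \<in> partial_orbit A {(a, b, c, d). a = 1 \<and> b = 0 \<and> c = 0 \<and> d = 1}"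
    unfolding partial_orbit_def by fastforce
  then show "partial_orbit A {(a, b, c, d). a = 1 \<and> b = 0 \<and> c = 0 \<and> d = 1} \<noteq> {}"
    by blast
qed

lemma irreducible_chain_step:
  assumes "irreducible_chain n (partial_orbit A S')" "A \<in> Bil2"
    and "polynomial_fun q" "S' \<subseteq> S" "line_closed S"
    and zero: "\<And>a b c d. (a, b, c, d) \<in> S' \<Longrightarrow> a * d - b * c \<noteq> 0 \<Longrightarrow> q (act (lin a b c d) A) = 0"
    and "(a, b, c, d) \<in> S" "a * d - b * c \<noteq> 0" "q (act (lin a b c d) A) \<noteq> 0"
  shows "irreducible_chain (Suc n) (partial_orbit A S)"
proof (rule irreducible_chain.step[OF assms(1) _ _ assms(3) _ _ assms(9)])
  show mem: "act (lin a b c d) A \<in> partial_orbit A S"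
    unfolding partial_orbit_def using assms(7,8) by blast
  then show "irreducible_set (partial_orbit A S)"
    by (intro irreducible_partial_orbit assms(2,5)) blast
  show "partial_orbit A S' \<subseteq> partial_orbit A S"
    unfolding partial_orbit_def using assms(4) by blast
  show "q B = 0" if "B \<in> partial_orbit A S'" for B
    using that zero unfolding partial_orbit_def by blast
qed

lemma orbit_dim_ge:
  assumes "irreducible_chain n (partial_orbit A S)" "A \<in> Bil2"
  shows "enat n \<le> orbit_dim A"
  unfolding orbit_dim_def
  by (rule krull_dim_ge[OF assms(1) partial_orbit_subset orbit_Bil2[OF assms(2)]])

section \<open>Flags of matrices for the individual algebras\<close>

lemma polynomial_fun_fst: "polynomial_fun (\<lambda>A. fst A e1 e1 $ k)" "polynomial_fun (\<lambda>A. fst A e1 e2 $ k)"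
    "polynomial_fun (\<lambda>A. fst A e2 e2 $ k)"
  and polynomial_fun_snd: "polynomial_fun (\<lambda>A. snd A e1 e1 $ k)" "polynomial_fun (\<lambda>A. snd A e1 e2 $ k)"
  unfolding e1_def e2_def by (rule polynomial_fun.coord_fst polynomial_fun.coord_snd)+

lemma polynomial_fun_diff:
  assumes "polynomial_fun p" "polynomial_fun q" shows "polynomial_fun (\<lambda>A. p A - q A)"
  using polynomial_fun.add[OF assms(1) polynomial_fun.mult[OF polynomial_fun.const[of "-1"] assms(2)]]
  by simp

lemmas polynomial_fun_intros = polynomial_fun_diff polynomial_fun_power polynomial_fun.const
  polynomial_fun_fst polynomial_fun_snd

lemma bil_Bil2: "(bil p11 p12 p21 p22, bil q11 q12 q21 q22) \<in> Bil2"
  by (simp add: Bil2_def)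

lemmas chain_simps = act_lin[OF bil_Bil2 refl] line_closed_def power2_eq_square

text \<open>The flag frees one matrix entry per step, and as many entries in all as the orbit has
  dimensions. In each step the polynomial detects the new entry, and the four numbers are the
  entries \<open>a\<close>, \<open>b\<close>, \<open>c\<close>, \<open>d\<close> of a matrix where
  it is nonzero.\<close>

lemma orbit_dim_T1_ge: "2 \<le> orbit_dim (alg T1)"
proof -
  note 0 = irreducible_chain_start[OF alg_Bil2, of "T1"]
  have 1: "irreducible_chain (Suc 0) (partial_orbit (alg T1) {(a, b, c, d). a = 1 \<and> b = 0 \<and> c = 0})"
    by (rule irreducible_chain_step[OF 0 alg_Bil2, of "\<lambda>A. snd A e1 e1 $ 2 - 1" _ 1 0 0 2])
      (intro polynomial_fun_intros, auto simp: chain_simps)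
  have 2: "irreducible_chain (Suc (Suc 0)) (partial_orbit (alg T1) {(a, b, c, d). a = 1 \<and> c = 0})"
    by (rule irreducible_chain_step[OF 1 alg_Bil2, of "\<lambda>A. snd A e1 e1 $ 1" _ 1 1 0 1])
      (intro polynomial_fun_intros, auto simp: chain_simps)
  from orbit_dim_ge[OF 2 alg_Bil2] show ?thesis by (simp add: numeral_eq_enat numeral_eq_Suc)
qed

lemma orbit_dim_T7_ge: "2 \<le> orbit_dim (alg (T7 \<alpha>))"
proof -
  note 0 = irreducible_chain_start[OF alg_Bil2, of "T7 \<alpha>"]
  have 1: "irreducible_chain (Suc 0) (partial_orbit (alg (T7 \<alpha>)) {(a, b, c, d). a = 1 \<and> b = 0 \<and> c = 0})"
    by (rule irreducible_chain_step[OF 0 alg_Bil2, of "\<lambda>A. fst A e1 e1 $ 2 - 1" _ 1 0 0 2])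
      (intro polynomial_fun_intros, auto simp: chain_simps)
  have 2: "irreducible_chain (Suc (Suc 0)) (partial_orbit (alg (T7 \<alpha>)) {(a, b, c, d). a = 1 \<and> c = 0})"
    by (rule irreducible_chain_step[OF 1 alg_Bil2, of "\<lambda>A. fst A e1 e1 $ 1" _ 1 1 0 1])
      (intro polynomial_fun_intros, auto simp: chain_simps)
  from orbit_dim_ge[OF 2 alg_Bil2] show ?thesis by (simp add: numeral_eq_enat numeral_eq_Suc)
qed

lemma orbit_dim_T2_ge: "2 \<le> orbit_dim (alg T2)"
proof -
  note 0 = irreducible_chain_start[OF alg_Bil2, of "T2"]
  \<comment> \<open>The matrices diag(1, d) stabilise \<open>T2\<close>, so \<open>a\<close> is
    freed in place of \<open>d\<close>. The same holds for \<open>T5\<close> and \<open>T6\<close>,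
    whose flags keep \<open>d = 1\<close> throughout.\<close>
  have 1: "irreducible_chain (Suc 0) (partial_orbit (alg T2) {(a, b, c, d). b = 0 \<and> c = 0 \<and> d = 1})"
    by (rule irreducible_chain_step[OF 0 alg_Bil2, of "\<lambda>A. snd A e1 e2 $ 2 - 1" _ 2 0 0 1])
      (intro polynomial_fun_intros, auto simp: chain_simps)
  have 2: "irreducible_chain (Suc (Suc 0)) (partial_orbit (alg T2) {(a, b, c, d). c = 0 \<and> d = 1})"
    by (rule irreducible_chain_step[OF 1 alg_Bil2, of "\<lambda>A. snd A e1 e2 $ 1" _ 1 1 0 1])
      (intro polynomial_fun_intros, auto simp: chain_simps)
  from orbit_dim_ge[OF 2 alg_Bil2] show ?thesis by (simp add: numeral_eq_enat numeral_eq_Suc)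
qed

lemma orbit_dim_T8_ge: "3 \<le> orbit_dim (alg T8)"
proof -
  note 0 = irreducible_chain_start[OF alg_Bil2, of "T8"]
  have 1: "irreducible_chain (Suc 0) (partial_orbit (alg T8) {(a, b, c, d). b = 0 \<and> c = 0 \<and> d = 1})"
    by (rule irreducible_chain_step[OF 0 alg_Bil2, of "\<lambda>A. snd A e1 e2 $ 2 - 1" _ 2 0 0 1])
      (intro polynomial_fun_intros, auto simp: chain_simps)
  have 2: "irreducible_chain (Suc (Suc 0)) (partial_orbit (alg T8) {(a, b, c, d). b = 0 \<and> c = 0})"
    \<comment> \<open>Under diag(a, d) the two structure constants become d / a^2 and 1 / a, so the
      difference vanishes for every \<open>a\<close> exactly when \<open>d = 1\<close>.\<close>
    by (rule irreducible_chain_step[OF 1 alg_Bil2, of "\<lambda>A. fst A e1 e1 $ 2 - (snd A e1 e2 $ 2) ^ 2" _ 1 0 0 2])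
      (intro polynomial_fun_intros, auto simp: chain_simps)
  have 3: "irreducible_chain (Suc (Suc (Suc 0))) (partial_orbit (alg T8) {(a, b, c, d). c = 0})"
    by (rule irreducible_chain_step[OF 2 alg_Bil2, of "\<lambda>A. fst A e1 e1 $ 1" _ 1 1 0 1])
      (intro polynomial_fun_intros, auto simp: chain_simps)
  from orbit_dim_ge[OF 3 alg_Bil2] show ?thesis by (simp add: numeral_eq_enat numeral_eq_Suc)
qed

lemma orbit_dim_T6_ge: "3 \<le> orbit_dim (alg T6)"
proof -
  note 0 = irreducible_chain_start[OF alg_Bil2, of "T6"]
  have 1: "irreducible_chain (Suc 0) (partial_orbit (alg T6) {(a, b, c, d). b = 0 \<and> c = 0 \<and> d = 1})"
    by (rule irreducible_chain_step[OF 0 alg_Bil2, of "\<lambda>A. fst A e1 e1 $ 1 - 1" _ 2 0 0 1])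
      (intro polynomial_fun_intros, auto simp: chain_simps)
  have 2: "irreducible_chain (Suc (Suc 0)) (partial_orbit (alg T6) {(a, b, c, d). c = 0 \<and> d = 1})"
    by (rule irreducible_chain_step[OF 1 alg_Bil2, of "\<lambda>A. fst A e1 e2 $ 1" _ 1 1 0 1])
      (intro polynomial_fun_intros, auto simp: chain_simps)
  have 3: "irreducible_chain (Suc (Suc (Suc 0))) (partial_orbit (alg T6) {(a, b, c, d). d = 1})"
    by (rule irreducible_chain_step[OF 2 alg_Bil2, of "\<lambda>A. fst A e1 e1 $ 2" _ 1 0 1 1])
      (intro polynomial_fun_intros, auto simp: chain_simps)
  from orbit_dim_ge[OF 3 alg_Bil2] show ?thesis by (simp add: numeral_eq_enat numeral_eq_Suc)
qed

lemma orbit_dim_T5_ge: "3 \<le> orbit_dim (alg (T5 \<beta>))"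
proof -
  note 0 = irreducible_chain_start[OF alg_Bil2, of "T5 \<beta>"]
  have 1: "irreducible_chain (Suc 0) (partial_orbit (alg (T5 \<beta>)) {(a, b, c, d). b = 0 \<and> c = 0 \<and> d = 1})"
    by (rule irreducible_chain_step[OF 0 alg_Bil2, of "\<lambda>A. fst A e1 e1 $ 1 - 1" _ 2 0 0 1])
      (intro polynomial_fun_intros, auto simp: chain_simps)
  have 2: "irreducible_chain (Suc (Suc 0)) (partial_orbit (alg (T5 \<beta>)) {(a, b, c, d). c = 0 \<and> d = 1})"
    by (rule irreducible_chain_step[OF 1 alg_Bil2, of "\<lambda>A. fst A e2 e2 $ 2" _ 1 1 0 1])
      (intro polynomial_fun_intros, auto simp: chain_simps)
  have 3: "irreducible_chain (Suc (Suc (Suc 0))) (partial_orbit (alg (T5 \<beta>)) {(a, b, c, d). d = 1})"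
    by (rule irreducible_chain_step[OF 2 alg_Bil2, of "\<lambda>A. fst A e1 e1 $ 2" _ 1 0 1 1])
      (intro polynomial_fun_intros, auto simp: chain_simps)
  from orbit_dim_ge[OF 3 alg_Bil2] show ?thesis by (simp add: numeral_eq_enat numeral_eq_Suc)
qed

lemma orbit_dim_T4_ge: "4 \<le> orbit_dim (alg T4)"
proof -
  note 0 = irreducible_chain_start[OF alg_Bil2, of "T4"]
  have 1: "irreducible_chain (Suc 0) (partial_orbit (alg T4) {(a, b, c, d). b = 0 \<and> c = 0 \<and> d = 1})"
    by (rule irreducible_chain_step[OF 0 alg_Bil2, of "\<lambda>A. fst A e1 e1 $ 1 - 1" _ 2 0 0 1])
      (intro polynomial_fun_intros, auto simp: chain_simps)
  \<comment> \<open>Under diag(a, d) the constants used are d / a^2 for the bracket and 1 / a for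
    the product; the polynomial compares them so that \<open>a\<close> drops out of the condition
    \<open>d = 1\<close>.\<close>
  have 2: "irreducible_chain (Suc (Suc 0)) (partial_orbit (alg T4) {(a, b, c, d). b = 0 \<and> c = 0})"
    by (rule irreducible_chain_step[OF 1 alg_Bil2, of "\<lambda>A. snd A e1 e1 $ 2 - (fst A e1 e1 $ 1) ^ 2" _ 1 0 0 2])
      (intro polynomial_fun_intros, auto simp: chain_simps)
  have 3: "irreducible_chain (Suc (Suc (Suc 0))) (partial_orbit (alg T4) {(a, b, c, d). c = 0})"
    by (rule irreducible_chain_step[OF 2 alg_Bil2, of "\<lambda>A. fst A e2 e2 $ 2" _ 1 1 0 1])
      (intro polynomial_fun_intros, auto simp: chain_simps)
  have 4: "irreducible_chain (Suc (Suc (Suc (Suc 0)))) (partial_orbit (alg T4) UNIV)"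
    by (rule irreducible_chain_step[OF 3 alg_Bil2, of "\<lambda>A. fst A e1 e1 $ 2" _ 1 0 1 1])
      (intro polynomial_fun_intros, auto simp: chain_simps)
  from orbit_dim_ge[OF 4 alg_Bil2] show ?thesis by (simp add: numeral_eq_enat numeral_eq_Suc)
qed

lemma orbit_dim_T3_ge: "4 \<le> orbit_dim (alg T3)"
proof -
  note 0 = irreducible_chain_start[OF alg_Bil2, of "T3"]
  have 1: "irreducible_chain (Suc 0) (partial_orbit (alg T3) {(a, b, c, d). b = 0 \<and> c = 0 \<and> d = 1})"
    by (rule irreducible_chain_step[OF 0 alg_Bil2, of "\<lambda>A. fst A e1 e1 $ 1 - 1" _ 2 0 0 1])
      (intro polynomial_fun_intros, auto simp: chain_simps)
  have 2: "irreducible_chain (Suc (Suc 0)) (partial_orbit (alg T3) {(a, b, c, d). b = 0 \<and> c = 0})"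
    by (rule irreducible_chain_step[OF 1 alg_Bil2, of "\<lambda>A. fst A e2 e2 $ 2 - 1" _ 1 0 0 2])
      (intro polynomial_fun_intros, auto simp: chain_simps)
  have 3: "irreducible_chain (Suc (Suc (Suc 0))) (partial_orbit (alg T3) {(a, b, c, d). c = 0})"
    by (rule irreducible_chain_step[OF 2 alg_Bil2, of "\<lambda>A. fst A e2 e2 $ 1" _ 1 1 0 1])
      (intro polynomial_fun_intros, auto simp: chain_simps)
  have 4: "irreducible_chain (Suc (Suc (Suc (Suc 0)))) (partial_orbit (alg T3) UNIV)"
    by (rule irreducible_chain_step[OF 3 alg_Bil2, of "\<lambda>A. fst A e1 e1 $ 2" _ 1 0 1 1])
      (intro polynomial_fun_intros, auto simp: chain_simps)
  from orbit_dim_ge[OF 4 alg_Bil2] show ?thesis by (simp add: numeral_eq_enat numeral_eq_Suc)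
qed

theorem lemma27:
  shows "(\<forall>t. transposed_Leibniz_Poisson (alg t)) \<and>
    orbit_dim (alg T3) = 4 \<and> orbit_dim (alg T4) = 4 \<and>
    (\<forall>\<beta>. orbit_dim (alg (T5 \<beta>)) = 3) \<and> orbit_dim (alg T6) = 3 \<and> orbit_dim (alg T8) = 3 \<and>
    orbit_dim (alg T1) = 2 \<and> orbit_dim (alg T2) = 2 \<and> (\<forall>\<alpha>. orbit_dim (alg (T7 \<alpha>)) = 2) \<and>
    orbit_dim (alg Zero) = 0 \<and>
    (\<forall>t t'. degenerates_to (alg t) (alg t') \<longleftrightarrow>
       isomorphic (alg t) (alg t') \<or> basic_degeneration\<^sup>+\<^sup>+ t t')"
proof (intro conjI allI)
  show "transposed_Leibniz_Poisson (alg t)" for t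
    by (rule transposed_Leibniz_Poisson_alg)
  show "orbit_dim (alg T3) = 4" by (rule antisym[OF orbit_dim_T3_le orbit_dim_T3_ge])
  show "orbit_dim (alg T4) = 4" by (rule antisym[OF orbit_dim_T4_le orbit_dim_T4_ge])
  show "orbit_dim (alg (T5 \<beta>)) = 3" for \<beta> by (rule antisym[OF orbit_dim_T5_le orbit_dim_T5_ge])
  show "orbit_dim (alg T6) = 3" by (rule antisym[OF orbit_dim_T6_le orbit_dim_T6_ge])
  show "orbit_dim (alg T8) = 3" by (rule antisym[OF orbit_dim_T8_le orbit_dim_T8_ge])
  show "orbit_dim (alg T1) = 2" by (rule antisym[OF orbit_dim_T1_le orbit_dim_T1_ge])
  show "orbit_dim (alg T2) = 2" by (rule antisym[OF orbit_dim_T2_le orbit_dim_T2_ge])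
  show "orbit_dim (alg (T7 \<alpha>)) = 2" for \<alpha> by (rule antisym[OF orbit_dim_T7_le orbit_dim_T7_ge])
  show "orbit_dim (alg Zero) = 0" using orbit_dim_Zero_le by simp
  show "degenerates_to (alg t) (alg t') \<longleftrightarrow>
      isomorphic (alg t) (alg t') \<or> basic_degeneration\<^sup>+\<^sup>+ t t'" for t t'
    by (rule degenerates_to_alg_iff)
qed

end
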